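(* Let $q_{\boldsymbol{\theta}}(\mathcal{U})$ (the generated distribution, $\boldsymbol{\theta}$ the generator parameters) and $p(\mathcal{U}\mid\mathcal{D},\boldsymbol{\nu})$ (the posterior, $\boldsymbol{\nu}$ the model hyperparameters) be suitably smooth probability densities of a vector $\mathcal{U}\in\mathbb{R}^m$, and let $\lambda>0$. Let $$\mathcal{L}(\boldsymbol{\theta},\boldsymbol{\nu})=\sup_{\boldsymbol{\phi}}\Big\{\mathbb{E}_{\mathcal{U}\sim q_{\boldsymbol{\theta}}}\big[(\nabla_{\mathcal{U}}\log p(\mathcal{U}\mid\mathcal{D},\boldsymbol{\nu}))^T\boldsymbol{\phi}(\mathcal{U})+\mathrm{Tr}(\nabla_{\mathcal{U}}\boldsymbol{\phi}(\mathcal{U}))\big]-\lambda\,\mathbb{E}_{\mathcal{U}\sim q_{\boldsymbol{\theta}}}\big[\boldsymbol{\phi}(\mathcal{U})^T\boldsymbol{\phi}(\mathcal{U})\big]\Big\}$$ be the loss of the generator under the optimal discriminator, the supremum being over all admissible discriminators $\boldsymbol{\phi}:\mathbb{R}^m\to\mathbb{R}^m$ (see context). Then $$\mathcal{L}(\boldsymbol{\theta},\boldsymbol{\nu})=\frac{1}{4\lambda}\,FD\big(q_{\boldsymbol{\theta}}(\mathcal{U}),p(\mathcal{U}\mid\mathcal{D},\boldsymbol{\nu})\big),$$ where $FD$ is the Fisher divergence. Consequently, training the generator (minimizing $\mathcal{L}$ over $\boldsymbol{\theta}$) with the optimal discriminator corresponds to minimizing the Fisher divergence between $q_{\boldsymbol{\theta}}$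 and $p(\cdot\mid\mathcal{D},\boldsymbol{\nu})$.
   Context: Fisher divergence: for two suitably smooth probability densities $q,p$ on $\mathbb{R}^m$, $$FD(q,p)=\int_{\mathbb{R}^m}\|\nabla\log q(\boldsymbol{x})-\nabla\log p(\boldsymbol{x})\|_2^2\,q(\boldsymbol{x})\,d\boldsymbol{x}.$$ "Suitably smooth" means that the densities are positive and differentiable, so that their score functions $\nabla\log q$, $\nabla\log p$ are defined. Langevin–Stein operator: for a density $p$ and a differentiable $\boldsymbol{\phi}:\mathbb{R}^m\to\mathbb{R}^m$, $\mathcal{A}_p\boldsymbol{\phi}(\boldsymbol{x})=(\nabla_{\boldsymbol{x}}\log p(\boldsymbol{x}))^T\boldsymbol{\phi}(\boldsymbol{x})+\mathrm{Tr}(\nabla_{\boldsymbol{x}}\boldsymbol{\phi}(\boldsymbol{x}))$, where $\nabla_{\boldsymbol{x}}\boldsymbol{\phi}$ is the Jacobian matrix. The quantity in braces in the claim is the Regularized Stein Discrepancy $\mathrm{RSD}(q_{\boldsymbol{\theta}},p;\boldsymbol{\phi})$ with regularization strength $\lambda$. Admissible discriminators: differentiable functions $\boldsymbol{\phi}:\mathbb{R}^m\to\mathbb{R}^m$ in $\mathcal{L}_2$, i.e. with $\mathbb{E}_{q_{\boldsymbol{\theta}}}\|\boldsymbol{\phi}\|_2^2<\infty$, for which the expectation $\mathbb{E}_{q_{\boldsymbol{\theta}}}[\mathcal{A}_p\boldsymbol{\phi}]$ is defined and Stein's identity holds for $q_{\boldsymbol{\theta}}$, i.e. $\mathbb{E}_{q_{\boldsymbol{\theta}}}[\mathcal{A}_{q_{\boldsymbol{\theta}}}\boldsymbol{\phi}]=0$.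 The "optimal discriminator" means that the maximization is over this whole function class, not limited by a finite parameterization. *)

theory Defs
  imports "HOL-Analysis.Analysis"
begin

definition gradient :: "('a::real_inner \<Rightarrow> real) \<Rightarrow> 'a \<Rightarrow> 'a" where
  "gradient f x = (THE D. GDERIV f x :> D)"

definition smooth_density :: "(real^'m \<Rightarrow> real) \<Rightarrow> bool" where
  "smooth_density p \<longleftrightarrow>
     (\<forall>x. p x > 0) \<and> p differentiable_on UNIV \<and> has_bochner_integral lborel p 1"

definition score :: "(real^'m \<Rightarrow> real) \<Rightarrow> real^'m \<Rightarrow> real^'m" where
  "score p = gradient (\<lambda>x. ln (p x))"

definition distr_of :: "(real^'m \<Rightarrow> real) \<Rightarrow> (real^'m) measure" where
  "distr_of q = density lborel (\<lambda>x. ennreal (q x))"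

(* The integrand is nonnegative but need not be integrable, so the divergence may be infinite. *)
definition fisher_div :: "(real^'m \<Rightarrow> real) \<Rightarrow> (real^'m \<Rightarrow> real) \<Rightarrow> ennreal" where
  "fisher_div q p =
     (\<integral>\<^sup>+ x. ennreal ((norm (score q x - score p x))\<^sup>2 * q x) \<partial>lborel)"

definition stein_op :: "(real^'m \<Rightarrow> real) \<Rightarrow> (real^'m \<Rightarrow> real^'m) \<Rightarrow> real^'m \<Rightarrow> real" where
  "stein_op p \<phi> x = score p x \<bullet> \<phi> x + trace (jacobian \<phi> (at x))"

(* Integrability is demanded explicitly because the Bochner integral of a non-integrable
   function is 0 by convention; in particular Stein's identity is the statement that
   the expectation exists and equals 0. *)
definition admissible ::
  "(real^'m \<Rightarrow> real) \<Rightarrow> (real^'m \<Rightarrow> real) \<Rightarrow> (real^'m \<Rightarrow> real^'m) set" where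
  "admissible q p = {\<phi>.
     \<phi> differentiable_on UNIV \<and>
     integrable (distr_of q) (\<lambda>x. (norm (\<phi> x))\<^sup>2) \<and>
     integrable (distr_of q) (stein_op p \<phi>) \<and>
     has_bochner_integral (distr_of q) (stein_op q \<phi>) 0}"

definition RSD ::
  "real \<Rightarrow> (real^'m \<Rightarrow> real) \<Rightarrow> (real^'m \<Rightarrow> real) \<Rightarrow> (real^'m \<Rightarrow> real^'m) \<Rightarrow> real" where
  "RSD lam q p \<phi> =
     (LINT x|distr_of q. stein_op p \<phi> x) - lam * (LINT x|distr_of q. \<phi> x \<bullet> \<phi> x)"

definition optimal_loss :: "real \<Rightarrow> (real^'m \<Rightarrow> real) \<Rightarrow> (real^'m \<Rightarrow> real) \<Rightarrow> ereal" where
  "optimal_loss lam q p = (SUP \<phi> \<in> admissible q p. ereal (RSD lam q p \<phi>))"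

end

theory Submission
  imports Defs
begin

text \<open>
  Write \<open>\<delta>\<close> for the difference of the scores of \<open>p\<close> and \<open>q\<close>. Stein's identity turns the expectation of
  \<open>\<A>\<^sub>p \<phi>\<close> into that of \<open>\<delta> \<bullet> \<phi>\<close>, and completing the square gives the upper bound, attained formally at
  \<open>\<phi> = \<delta> / (2 \<lambda>)\<close>. As \<open>\<delta>\<close> is merely a pointwise limit of continuous functions, it is
  approximated by \<open>F / q\<close> with \<open>F\<close> Lipschitz, differentiable and vanishing outside a bounded open set
  on which \<open>\<delta>\<close> is square integrable; such fields always satisfy Stein's identity, and they are dense in
  \<open>L\<^sup>2\<close>. A Baire category argument shows that these open sets exhaust the Fisher divergence, even if
  \<open>\<delta>\<close> is not locally square integrable everywhere.
\<close>

section \<open>Integrals of directional derivatives\<close>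

lemma difference_quotient_tendsto:
  fixes f :: "'a::real_normed_vector \<Rightarrow> real"
  assumes "(f has_derivative D) (at x)"
  shows "(\<lambda>n. real (Suc n) * (f (x + inverse (real (Suc n)) *\<^sub>R v) - f x)) \<longlonglongrightarrow> D v"
proof -
  interpret bounded_linear D using assms by (rule has_derivative_bounded_linear)
  have "((\<lambda>t. f (x + t *\<^sub>R v)) has_derivative (\<lambda>t. D (t *\<^sub>R v))) (at 0)"
    by (rule has_derivative_compose[where g = f]) (auto intro!: derivative_eq_intros simp: assms)
  then have "((\<lambda>t. f (x + t *\<^sub>R v)) has_real_derivative D v) (at 0)"
    by (rule has_derivative_imp_has_field_derivative) (simp add: scale)
  then have lim: "((\<lambda>t. (f (x + t *\<^sub>R v) - f x) / t) \<longlongrightarrow> D v) (at 0)"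
    by (simp add: has_field_derivative_iff)
  have "filterlim (\<lambda>n. inverse (real (Suc n))) (at 0) sequentially"
    using LIMSEQ_inverse_real_of_nat by (auto simp: filterlim_at)
  from filterlim_compose[OF lim this] show ?thesis
    by (simp add: divide_inverse mult.commute)
qed

text \<open>By translation invariance every difference quotient integrates to \<open>0\<close>;
  the Lipschitz bound lets dominated convergence pass to the derivative.\<close>

lemma integral_directional_derivative_eq_0:
  fixes h :: "'a::euclidean_space \<Rightarrow> real"
  assumes der: "\<And>x. (h has_derivative h' x) (at x)"
    and lip: "L-lipschitz_on UNIV h"
    and B: "bounded B" "\<And>x. x \<notin> B \<Longrightarrow> h x = 0"
  shows "has_bochner_integral lborel (\<lambda>x. h' x v) 0"
proof -
  obtain R where R: "\<And>x. x \<in> B \<Longrightarrow> norm x \<le> R"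
    using B(1) by (auto simp: bounded_iff)
  have h0: "h x = 0" if "norm x > R" for x
    using that R[of x] B(2)[of x] by fastforce
  have cont: "continuous_on UNIV h"
    using lip by (rule lipschitz_on_continuous_on)
  have [measurable]: "h \<in> borel_measurable borel"
    using cont by (rule borel_measurable_continuous_onI)
  have "integrable lborel (\<lambda>x. indicator (cball 0 R) x *\<^sub>R h x)"
    by (rule borel_integrable_compact) (auto intro: continuous_on_subset[OF cont])
  also have "(\<lambda>x. indicator (cball 0 R) x *\<^sub>R h x) = h"
    by (auto simp: fun_eq_iff indicator_def h0)
  finally have int: "integrable lborel h" .
  have trans: "integrable lborel (\<lambda>x. h (x + c))" "(\<integral>x. h (x + c) \<partial>lborel) = (\<integral>x. h x \<partial>lborel)" for c
  proof -
    have "distr lborel borel ((+) c) = lborel" by (rule lborel_distr_plus)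
    then show "integrable lborel (\<lambda>x. h (x + c))" "(\<integral>x. h (x + c) \<partial>lborel) = (\<integral>x. h x \<partial>lborel)"
      using integrable_distr_eq[of "(+) c" lborel borel h] integral_distr[of "(+) c" lborel borel h] int
      by (simp_all add: add.commute)
  qed
  define s where "s n x = real (Suc n) * (h (x + inverse (real (Suc n)) *\<^sub>R v) - h x)" for n x
  have [measurable]: "s n \<in> borel_measurable borel" for n
    unfolding s_def[abs_def] by measurable
  have s0: "(\<integral>x. s n x \<partial>lborel) = 0" for n
    unfolding s_def using trans int by simp
  have lim: "(\<lambda>n. s n x) \<longlonglongrightarrow> h' x v" for x
    unfolding s_def by (rule difference_quotient_tendsto[OF der])
  have meas: "(\<lambda>x. h' x v) \<in> borel_measurable lborel"
    using lim by (rule borel_measurable_LIMSEQ_metric[rotated]) simp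
  \<comment> \<open>The dominating function: if \<open>norm x > R + norm v\<close>, then
    \<open>x\<close> and all its shifts by \<open>v / (n+1)\<close> have norm above
    \<open>R\<close>, where \<open>h\<close> vanishes; inside that ball the Lipschitz bound gives
    \<open>L * norm v\<close>, because the factor \<open>n+1\<close> cancels.\<close>
  define w where "w x = indicator (cball 0 (R + norm v)) x *\<^sub>R (L * norm v)" for x :: 'a
  have w: "integrable lborel w"
    unfolding w_def by (rule borel_integrable_compact) auto
  have bd: "norm (s n x) \<le> w x" for n x
  proof (cases "norm x \<le> R + norm v")
    case True
    have "\<bar>h (x + inverse (real (Suc n)) *\<^sub>R v) - h x\<bar> \<le> L * norm (inverse (real (Suc n)) *\<^sub>R v)"
      using lipschitz_on_normD[OF lip, of "x + inverse (real (Suc n)) *\<^sub>R v" x] by simp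
    then have "real (Suc n) * \<bar>h (x + inverse (real (Suc n)) *\<^sub>R v) - h x\<bar>
      \<le> real (Suc n) * (L * norm (inverse (real (Suc n)) *\<^sub>R v))"
      by (intro mult_left_mono) auto
    also have "\<dots> = L * norm v" by (simp add: field_simps)
    finally show ?thesis using True by (simp add: s_def w_def abs_mult)
  next
    case False
    have "norm (inverse (real (Suc n)) *\<^sub>R v) \<le> norm v"
      by (simp add: mult_left_le_one_le inverse_le_1_iff)
    then have "norm (x + inverse (real (Suc n)) *\<^sub>R v) > R"
      using False norm_diff_ineq[of x "inverse (real (Suc n)) *\<^sub>R v"] by linarith
    moreover have "norm x > R" using False norm_ge_zero[of v] by linarith
    ultimately show ?thesis using False by (simp add: s_def w_def h0)
  qed
  have "integrable lborel (\<lambda>x. h' x v)"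
    by (rule integrable_dominated_convergence[OF meas _ w, of s]) (use lim bd in auto)
  moreover have "(\<lambda>n. \<integral>x. s n x \<partial>lborel) \<longlonglongrightarrow> (\<integral>x. h' x v \<partial>lborel)"
    by (rule integral_dominated_convergence[OF meas _ w]) (use lim bd in auto)
  then have "(\<integral>x. h' x v \<partial>lborel) = 0"
    unfolding s0 LIMSEQ_const_iff by simp
  ultimately show ?thesis by (simp add: has_bochner_integral_iff)
qed

section \<open>Differentiable Lipschitz maps vanishing outside an open set\<close>

text \<open>The Lipschitz bound dominates difference quotients, so the derivative need not be
  continuous. Vanishing off \<open>B\<close>, instead of having compact support inside
  \<open>B\<close>, lets bumps that fill whole balls of \<open>B\<close> belong to the
  class.\<close>

definition test_maps :: "'a::euclidean_space set \<Rightarrow> ('a \<Rightarrow> 'b::euclidean_space) set" where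
  "test_maps B = {F. (\<forall>x. F differentiable (at x)) \<and> (\<exists>L. L-lipschitz_on UNIV F) \<and> (\<forall>x. x \<notin> B \<longrightarrow> F x = 0)}"

lemma zero_in_test_maps: "(\<lambda>x. 0) \<in> test_maps B"
  by (auto simp: test_maps_def intro: lipschitz_intros)

lemma test_maps_add:
  assumes "F \<in> test_maps B" "G \<in> test_maps B"
  shows "(\<lambda>x. F x + G x) \<in> test_maps B"
  using assms by (auto simp: test_maps_def intro: lipschitz_intros)

lemma test_maps_scaleR:
  assumes "h \<in> test_maps B"
  shows "(\<lambda>x. h x *\<^sub>R c) \<in> test_maps B"
proof -
  obtain L where L: "L-lipschitz_on UNIV h" using assms by (auto simp: test_maps_def)
  have "(L * norm c)-lipschitz_on UNIV (\<lambda>x. h x *\<^sub>R c)"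
  proof (rule lipschitz_onI)
    fix x y
    show "dist (h x *\<^sub>R c) (h y *\<^sub>R c) \<le> L * norm c * dist x y"
      using mult_right_mono[OF lipschitz_onD[OF L, of x y] norm_ge_zero[of c]]
      by (simp add: dist_norm scaleR_left_diff_distrib[symmetric] mult_ac)
  qed (use lipschitz_on_nonneg[OF L] in simp)
  then show ?thesis using assms by (auto simp: test_maps_def)
qed

section \<open>Differentiable bumps on balls\<close>

lemma has_real_derivative_max_0_squared:
  "((\<lambda>t::real. (max 0 t)\<^sup>2) has_real_derivative 2 * max 0 t) (at t)"
proof -
  consider "t > 0" | "t < 0" | "t = 0" by linarith
  then show ?thesis
  proof cases
    case 1
    have "((\<lambda>t. t\<^sup>2) has_real_derivative 2 * t) (at t)"
      by (auto intro!: derivative_eq_intros)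
    then show ?thesis
      by (rule has_field_derivative_transform_within_open[where S = "{0<..}", THEN DERIV_cong])
         (use 1 in auto)
  next
    case 2
    have "((\<lambda>t. 0) has_real_derivative 0) (at t)" by simp
    then show ?thesis
      by (rule has_field_derivative_transform_within_open[where S = "{..<0}", THEN DERIV_cong])
         (use 2 in auto)
  next
    case 3
    \<comment> \<open>At the kink the square is decisive: the difference quotient is at most
      \<open>\<bar>h\<bar>\<close>, hence tends to 0.\<close>
    have "((\<lambda>h::real. (max 0 h)\<^sup>2 / h) \<longlongrightarrow> 0) (at 0)"
    proof (rule Lim_null_comparison)
      show "\<forall>\<^sub>F h in at 0. norm ((max 0 h)\<^sup>2 / h) \<le> \<bar>h::real\<bar>"
        by (rule always_eventually) (auto simp: max_def power2_eq_square)
      show "((\<lambda>h::real. \<bar>h\<bar>) \<longlongrightarrow> 0) (at 0)" by (rule tendsto_rabs_zero) simp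
    qed
    then show ?thesis by (simp add: 3 has_field_derivative_iff)
  qed
qed

text \<open>The inner square removes the singularity of the norm at the centre, the outer one the
  kink of the positive part on the bounding sphere.\<close>

definition ball_bump :: "'a::euclidean_space \<Rightarrow> real \<Rightarrow> 'a \<Rightarrow> real" where
  "ball_bump c r x = (max 0 (r\<^sup>2 - (norm (x - c))\<^sup>2))\<^sup>2"

lemma ball_bump_pos_iff: "r \<ge> 0 \<Longrightarrow> ball_bump c r x > 0 \<longleftrightarrow> x \<in> ball c r"
proof -
  assume r: "r \<ge> 0"
  have "ball_bump c r x > 0 \<longleftrightarrow> (norm (x - c))\<^sup>2 < r\<^sup>2"
    by (auto simp: ball_bump_def max_def)
  also have "\<dots> \<longleftrightarrow> norm (x - c) < r"
    using r by (metis norm_ge_zero power2_less_imp_less power_strict_mono zero_less_numeral)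
  finally show ?thesis by (simp add: dist_norm norm_minus_commute)
qed

lemma ball_bump_nonneg: "ball_bump c r x \<ge> 0"
  by (simp add: ball_bump_def)

lemma ball_bump_differentiable: "ball_bump c r differentiable (at x)"
proof -
  have "((\<lambda>x. (max 0 (r\<^sup>2 - (x - c) \<bullet> (x - c)))\<^sup>2) has_derivative
      (\<lambda>h. 2 * max 0 (r\<^sup>2 - (x - c) \<bullet> (x - c)) * (0 - ((x - c) \<bullet> h + h \<bullet> (x - c))))) (at x)"
    by (rule has_derivative_compose[where g = "\<lambda>t. (max 0 t)\<^sup>2"
          and g' = "(*) (2 * max 0 (r\<^sup>2 - (x - c) \<bullet> (x - c)))"])
       (auto intro!: derivative_eq_intros has_real_derivative_max_0_squared
         simp flip: has_field_derivative_def)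
  then show ?thesis
    by (auto simp: ball_bump_def[abs_def] power2_norm_eq_inner differentiable_def)
qed

text \<open>Clipping the distance to the centre at \<open>r\<close> is 1-Lipschitz and leaves the
  bump unchanged. For clipped distances \<open>a\<close>, \<open>b\<close> the difference of the
  values factors into \<open>b - a\<close>, \<open>a + b\<close> and a sum of two terms of size at
  most \<open>r^2\<close>; the constant is \<open>2r * 2r^2\<close>.\<close>

lemma ball_bump_lipschitz:
  assumes "r \<ge> 0"
  shows "(4 * r ^ 3)-lipschitz_on UNIV (ball_bump c r)"
proof (rule lipschitz_onI)
  fix x y
  define a b where "a = min (norm (x - c)) r" and "b = min (norm (y - c)) r"
  have ab: "0 \<le> a" "a \<le> r" "0 \<le> b" "b \<le> r" using assms by (auto simp: a_def b_def)
  have sq: "a\<^sup>2 \<le> r\<^sup>2" "b\<^sup>2 \<le> r\<^sup>2" using ab by (auto intro: power_mono)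
  have clip: "max 0 (r\<^sup>2 - (norm (z - c))\<^sup>2) = r\<^sup>2 - (min (norm (z - c)) r)\<^sup>2" for z
  proof (cases "norm (z - c) \<le> r")
    case True
    then show ?thesis using power_mono[OF True norm_ge_zero, of 2] by (simp add: max_def min_def)
  next
    case False
    then have "r\<^sup>2 \<le> (norm (z - c))\<^sup>2" using assms by (intro power_mono) auto
    then show ?thesis using False by (simp add: max_def min_def)
  qed
  have nonneg: "0 \<le> (r\<^sup>2 - a\<^sup>2) + (r\<^sup>2 - b\<^sup>2)" "0 \<le> (a + b) * ((r\<^sup>2 - a\<^sup>2) + (r\<^sup>2 - b\<^sup>2))"
  proof -
    show "0 \<le> (r\<^sup>2 - a\<^sup>2) + (r\<^sup>2 - b\<^sup>2)" using sq by linarith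
    then show "0 \<le> (a + b) * ((r\<^sup>2 - a\<^sup>2) + (r\<^sup>2 - b\<^sup>2))"
      using ab by (intro mult_nonneg_nonneg) linarith+
  qed
  have "norm ((r\<^sup>2 - a\<^sup>2)\<^sup>2 - (r\<^sup>2 - b\<^sup>2)\<^sup>2) = \<bar>a - b\<bar> * ((a + b) * ((r\<^sup>2 - a\<^sup>2) + (r\<^sup>2 - b\<^sup>2)))"
  proof -
    have "(r\<^sup>2 - a\<^sup>2)\<^sup>2 - (r\<^sup>2 - b\<^sup>2)\<^sup>2 = (b - a) * ((a + b) * ((r\<^sup>2 - a\<^sup>2) + (r\<^sup>2 - b\<^sup>2)))"
      by algebra
    then show ?thesis using nonneg(2) by (simp only: real_norm_def abs_mult[of "b - a"] abs_minus_commute[of b a] abs_of_nonneg)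
  qed
  also have "\<dots> \<le> dist x y * ((2 * r) * (2 * r\<^sup>2))"
  proof (intro mult_mono)
    have "\<bar>a - b\<bar> \<le> \<bar>norm (x - c) - norm (y - c)\<bar>" by (auto simp: a_def b_def)
    also have "\<dots> \<le> norm ((x - c) - (y - c))" by (rule norm_triangle_ineq3)
    finally show "\<bar>a - b\<bar> \<le> dist x y" by (simp add: dist_norm)
    have "0 \<le> a\<^sup>2" "0 \<le> b\<^sup>2" by auto
    then show "(r\<^sup>2 - a\<^sup>2) + (r\<^sup>2 - b\<^sup>2) \<le> 2 * r\<^sup>2" by linarith
    show "a + b \<le> 2 * r" using ab by linarith
  qed (use nonneg assms in simp_all)
  finally show "dist (ball_bump c r x) (ball_bump c r y) \<le> 4 * r ^ 3 * dist x y"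
    unfolding ball_bump_def dist_real_def clip a_def[symmetric] b_def[symmetric]
    by (simp add: power3_eq_cube power2_eq_square mult_ac)
qed (use assms in simp)

lemma ball_bump_in_test_maps:
  assumes "r \<ge> 0" "ball c r \<subseteq> W"
  shows "ball_bump c r \<in> test_maps W"
  unfolding test_maps_def
proof (intro CollectI conjI allI impI exI)
  fix x assume "x \<notin> W"
  then have "\<not> ball_bump c r x > 0" using ball_bump_pos_iff[OF assms(1)] assms(2) by blast
  then show "ball_bump c r x = 0" using ball_bump_nonneg[of c r x] by linarith
qed (rule ball_bump_differentiable ball_bump_lipschitz[OF assms(1)])+

text \<open>The map \<open>t / (1 + t)\<close> is 1-Lipschitz on the nonnegative reals, fixes 0 and
  stays below 1. The factor \<open>n\<close> later drives positive values of \<open>w\<close>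
  towards 1 while zeros remain zeros.\<close>

lemma test_maps_saturate:
  fixes w :: "'a::euclidean_space \<Rightarrow> real"
  assumes w: "w \<in> test_maps W" and nn: "\<And>x. w x \<ge> 0"
  shows "(\<lambda>x. real n * w x / (1 + real n * w x)) \<in> test_maps W"
proof -
  obtain L where L: "L-lipschitz_on UNIV w" using w by (auto simp: test_maps_def)
  have pos: "1 + real n * w x > 0" for x using nn[of x] by (simp add: add_pos_nonneg)
  have "(real n * L)-lipschitz_on UNIV (\<lambda>x. real n * w x / (1 + real n * w x))"
  proof (rule lipschitz_onI)
    fix x y
    define a b where "a = real n * w x" and "b = real n * w y"
    have ab: "a \<ge> 0" "b \<ge> 0" using nn by (auto simp: a_def b_def)
    have "a / (1 + a) - b / (1 + b) = (a - b) / ((1 + a) * (1 + b))"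
      using ab by (simp add: field_simps)
    then have "\<bar>a / (1 + a) - b / (1 + b)\<bar> = \<bar>a - b\<bar> / ((1 + a) * (1 + b))"
      using ab by (simp add: abs_mult)
    also have "1 * 1 \<le> (1 + a) * (1 + b)" using ab by (intro mult_mono) auto
    then have "\<bar>a - b\<bar> / ((1 + a) * (1 + b)) \<le> \<bar>a - b\<bar> / 1" 
      by (intro divide_left_mono) auto
    also have "\<dots> = real n * \<bar>w x - w y\<bar>"
      by (simp add: a_def b_def abs_mult flip: right_diff_distrib)
    also have "\<dots> \<le> real n * (L * dist x y)"
      using lipschitz_onD[OF L, of x y] by (intro mult_left_mono) (auto simp: dist_real_def)
    finally show "dist (real n * w x / (1 + real n * w x)) (real n * w y / (1 + real n * w y)) \<le> real n * L * dist x y"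
      by (simp add: dist_real_def a_def b_def)
  qed (use lipschitz_on_nonneg[OF L] in simp)
  moreover have "(\<lambda>x. real n * w x / (1 + real n * w x)) differentiable (at x)" for x
    using w pos[of x] by (intro differentiable_divide differentiable_add differentiable_mult) (auto simp: test_maps_def)
  ultimately show ?thesis using w by (auto simp: test_maps_def)
qed

section \<open>Indicators of open sets as limits of test functions\<close>

lemma open_eq_Union_countable_balls:
  fixes W :: "'a::euclidean_space set"
  assumes "open W"
  obtains c :: "nat \<Rightarrow> 'a" and r where "\<And>k. r k \<ge> 0" "W = (\<Union>k. ball (c k) (r k))"
proof -
  define \<F> where "\<F> = {ball x e |x e. e \<ge> 0 \<and> ball x e \<subseteq> W}"
  obtain \<F>' where F': "\<F>' \<subseteq> \<F>" "countable \<F>'" "\<Union>\<F>' = \<Union>\<F>"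
    using Lindelof[of \<F>] by (auto simp: \<F>_def)
  \<comment> \<open>The degenerate ball is empty. It makes the family nonempty, so that it can be
    enumerated by all natural numbers even when \<open>W\<close> is empty; this is why radius 0 is
    allowed.\<close>
  define \<G> where "\<G> = insert (ball 0 0) \<F>'"
  have "W \<subseteq> \<Union>\<F>"
  proof
    fix x assume "x \<in> W"
    then obtain e where "e > 0" "ball x e \<subseteq> W" using assms by (meson open_contains_ball)
    then have "ball x e \<in> \<F>" "x \<in> ball x e" by (auto simp: \<F>_def intro: less_imp_le)
    then show "x \<in> \<Union>\<F>" by blast
  qed
  then have "\<Union>\<F> = W" by (auto simp: \<F>_def)
  then have U: "\<Union>\<G> = W" using F' by (simp add: \<G>_def)
  have balls: "\<exists>x e. e \<ge> 0 \<and> S = ball x e" if "S \<in> \<G>" for S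
    using F'(1) that unfolding \<G>_def \<F>_def by fast
  have range: "range (from_nat_into \<G>) = \<G>"
    using F'(2) by (intro range_from_nat_into) (auto simp: \<G>_def)
  have "\<exists>x e. e \<ge> 0 \<and> from_nat_into \<G> k = ball x e" for k
  proof (rule balls)
    show "from_nat_into \<G> k \<in> \<G>" using range by (metis rangeI)
  qed
  then obtain c r where cr: "\<And>k. r k \<ge> (0::real)" "\<And>k. from_nat_into \<G> k = ball (c k) (r k)"
    by metis
  have "W = (\<Union>k. from_nat_into \<G> k)"
    by (simp only: range U)
  then have "W = (\<Union>k. ball (c k) (r k))"
    by (simp only: cr(2))
  with cr(1) show ?thesis by (rule that)
qed

text \<open>Bumps on countably many balls exhausting \<open>W\<close> are summed up to
  \<open>n\<close> and saturated with factor \<open>n\<close>. Finite sums stay in the class, so no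
  series has to be differentiated, and the growing factor makes the limit 1 wherever a single bump
  is positive.\<close>

lemma indicator_open_limit_test_maps:
  fixes W :: "'a::euclidean_space set"
  assumes "open W"
  obtains h :: "nat \<Rightarrow> 'a \<Rightarrow> real" where "\<And>n. h n \<in> test_maps W" "\<And>n x. \<bar>h n x\<bar> \<le> 1"
    "\<And>x. (\<lambda>n. h n x) \<longlonglongrightarrow> indicator W x"
proof -
  obtain c :: "nat \<Rightarrow> 'a" and r where r: "\<And>k. r k \<ge> 0" and W: "W = (\<Union>k. ball (c k) (r k))"
    using open_eq_Union_countable_balls[OF assms] by metis
  define w where "w n x = (\<Sum>k<n. ball_bump (c k) (r k) x)" for n x
  define h where "h n x = real n * w n x / (1 + real n * w n x)" for n x
  have w: "w n \<in> test_maps W" for n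
  proof (induction n)
    case 0
    then show ?case by (simp add: w_def[abs_def] zero_in_test_maps)
  next
    case (Suc n)
    have "ball_bump (c n) (r n) \<in> test_maps W" by (rule ball_bump_in_test_maps) (use r W in auto)
    from test_maps_add[OF Suc this] show ?case by (simp add: w_def[abs_def])
  qed
  have nn: "w n x \<ge> 0" for n x by (simp add: w_def sum_nonneg ball_bump_nonneg)
  have nn': "real n * w n x \<ge> 0" for n x using nn by simp
  show thesis
  proof
    show "h n \<in> test_maps W" for n
      unfolding h_def[abs_def] by (rule test_maps_saturate[OF w nn])
    show "\<bar>h n x\<bar> \<le> 1" for n x
      using nn'[of n x] by (auto simp: h_def field_simps)
    show "(\<lambda>n. h n x) \<longlonglongrightarrow> indicator W x" for x
    proof (cases "x \<in> W")
      case False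
      then have "h n x = 0" for n using w[of n] by (auto simp: h_def test_maps_def)
      then show ?thesis using False by simp
    next
      case True
      then obtain k where "x \<in> ball (c k) (r k)" using W by auto
      then have b: "ball_bump (c k) (r k) x > 0" using ball_bump_pos_iff[OF r] by blast
      let ?b = "ball_bump (c k) (r k) x"
      have "(\<lambda>n. 1 - 1 / (1 + real n * w n x)) \<longlonglongrightarrow> 1 - 0"
      proof (intro tendsto_diff tendsto_const tendsto_divide_0[OF tendsto_const] filterlim_at_top_imp_at_infinity)
        have "filterlim (\<lambda>n. ?b * real n) at_top sequentially"
          by (rule filterlim_tendsto_pos_mult_at_top[OF tendsto_const b filterlim_real_sequentially])
        \<comment> \<open>Once \<open>n > k\<close>, the partial sum contains the bump that is
          positive at \<open>x\<close>, so \<open>real n * w n x\<close> grows at least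
          linearly.\<close>
        moreover have "\<forall>\<^sub>F n in sequentially. ?b * real n \<le> 1 + real n * w n x"
          using eventually_gt_at_top[of k]
        proof eventually_elim
          case (elim n)
          have "?b \<le> w n x" unfolding w_def
            by (rule member_le_sum) (use elim ball_bump_nonneg in auto)
          then have "real n * ?b \<le> real n * w n x" by (intro mult_left_mono) auto
          then show ?case by (simp add: mult.commute)
        qed
        ultimately show "filterlim (\<lambda>n. 1 + real n * w n x) at_top sequentially"
          by (rule filterlim_at_top_mono)
      qed
      moreover have "1 - 1 / (1 + real n * w n x) = h n x" for n
        using nn'[of n x] by (simp add: h_def field_simps)
      ultimately show ?thesis using True by simp
    qed
  qed
qed

section \<open>Density in square-integrable maps\<close>

lemma norm_add_squared_le: "(norm (a + b))\<^sup>2 \<le> 2 * (norm a)\<^sup>2 + 2 * (norm b)\<^sup>2"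
  for a b :: "'a::real_normed_vector"
proof -
  have "(norm (a + b))\<^sup>2 \<le> (norm a + norm b)\<^sup>2" by (intro power_mono norm_triangle_ineq) auto
  also have "\<dots> \<le> 2 * (norm a)\<^sup>2 + 2 * (norm b)\<^sup>2"
    using zero_le_power2[of "norm a - norm b"] by (simp add: power2_eq_square algebra_simps)
  finally show ?thesis .
qed

text \<open>A substitute for Minkowski's inequality on squared norms; the factor 2 does no harm in
  density arguments and square roots are avoided.\<close>

lemma nn_integral_norm_add_squared_le:
  fixes f g :: "'a \<Rightarrow> 'b::euclidean_space"
  assumes [measurable]: "f \<in> borel_measurable M" "g \<in> borel_measurable M"
  shows "(\<integral>\<^sup>+x. ennreal ((norm (f x + g x))\<^sup>2) \<partial>M)
    \<le> 2 * (\<integral>\<^sup>+x. ennreal ((norm (f x))\<^sup>2) \<partial>M) + 2 * (\<integral>\<^sup>+x. ennreal ((norm (g x))\<^sup>2) \<partial>M)"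
proof -
  have "(\<integral>\<^sup>+x. ennreal ((norm (f x + g x))\<^sup>2) \<partial>M)
      \<le> (\<integral>\<^sup>+x. 2 * ennreal ((norm (f x))\<^sup>2) + 2 * ennreal ((norm (g x))\<^sup>2) \<partial>M)"
  proof (rule nn_integral_mono)
    fix x
    have "ennreal ((norm (f x + g x))\<^sup>2) \<le> ennreal (2 * (norm (f x))\<^sup>2 + 2 * (norm (g x))\<^sup>2)"
      by (intro ennreal_leI norm_add_squared_le)
    also have "\<dots> = 2 * ennreal ((norm (f x))\<^sup>2) + 2 * ennreal ((norm (g x))\<^sup>2)"
      by (simp add: ennreal_plus ennreal_mult)
    finally show "ennreal ((norm (f x + g x))\<^sup>2) \<le> 2 * ennreal ((norm (f x))\<^sup>2) + 2 * ennreal ((norm (g x))\<^sup>2)" .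
  qed
  also have "\<dots> = 2 * (\<integral>\<^sup>+x. ennreal ((norm (f x))\<^sup>2) \<partial>M) + 2 * (\<integral>\<^sup>+x. ennreal ((norm (g x))\<^sup>2) \<partial>M)"
    by (simp add: nn_integral_add nn_integral_cmult)
  finally show ?thesis .
qed

lemma test_maps_borel_measurable:
  assumes "F \<in> test_maps B" "sets M = sets borel"
  shows "F \<in> borel_measurable M"
proof -
  obtain L where "L-lipschitz_on UNIV F" using assms by (auto simp: test_maps_def)
  then have "F \<in> borel_measurable borel"
    by (intro borel_measurable_continuous_onI lipschitz_on_continuous_on)
  then show ?thesis using assms(2) by (simp cong: measurable_cong_sets)
qed

text \<open>The nonnegative integral permits infinite distances, so no integrability conditions
  accompany the closure properties. The bound \<open>e\<close> is on the squared distance.\<close>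

definition L2_approximable ::
    "'a::euclidean_space measure \<Rightarrow> 'a set \<Rightarrow> ('a \<Rightarrow> 'b::euclidean_space) \<Rightarrow> bool" where
  "L2_approximable M B g \<longleftrightarrow> g \<in> borel_measurable M \<and>
     (\<forall>e>0. \<exists>F\<in>test_maps B. (\<integral>\<^sup>+x. ennreal ((norm (F x - g x))\<^sup>2) \<partial>M) < ennreal e)"

lemma L2_approximable_zero: "L2_approximable M B (\<lambda>x. 0)"
  unfolding L2_approximable_def by (auto intro!: bexI[OF _ zero_in_test_maps])

lemma L2_approximable_test_maps:
  assumes "F \<in> test_maps B" "sets M = sets borel"
  shows "L2_approximable M B F"
  unfolding L2_approximable_def using assms test_maps_borel_measurable by (auto intro!: bexI[of _ F])

lemma ennreal_mult_2_quarters: "e > 0 \<Longrightarrow> 2 * ennreal (e / 4) + 2 * ennreal (e / 4) = ennreal e"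
  by (simp flip: ennreal_numeral ennreal_mult ennreal_plus)

lemma L2_approximable_closure:
  assumes M: "sets M = sets borel" and g[measurable]: "g \<in> borel_measurable M"
    and ap: "\<And>e. e > 0 \<Longrightarrow> \<exists>f. L2_approximable M B f \<and> (\<integral>\<^sup>+x. ennreal ((norm (f x - g x))\<^sup>2) \<partial>M) < ennreal e"
  shows "L2_approximable M B g"
  unfolding L2_approximable_def
proof (intro conjI allI impI g)
  fix e :: real assume "e > 0"
  \<comment> \<open>Two errors below \<open>e / 4\<close>, each doubled by the inequality for
    squared norms, add up to less than \<open>e\<close>.\<close>
  then have e: "e / 4 > 0" by simp
  obtain f where f: "L2_approximable M B f" "(\<integral>\<^sup>+x. ennreal ((norm (f x - g x))\<^sup>2) \<partial>M) < ennreal (e / 4)"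
    using ap[OF e] by blast
  then obtain F where F: "F \<in> test_maps B" "(\<integral>\<^sup>+x. ennreal ((norm (F x - f x))\<^sup>2) \<partial>M) < ennreal (e / 4)"
    using e unfolding L2_approximable_def by blast
  have [measurable]: "f \<in> borel_measurable M" "F \<in> borel_measurable M"
    using f(1) test_maps_borel_measurable[OF F(1) M] by (auto simp: L2_approximable_def)
  have "(\<integral>\<^sup>+x. ennreal ((norm (F x - g x))\<^sup>2) \<partial>M) = (\<integral>\<^sup>+x. ennreal ((norm ((F x - f x) + (f x - g x)))\<^sup>2) \<partial>M)"
    by simp
  also have "\<dots> \<le> 2 * (\<integral>\<^sup>+x. ennreal ((norm (F x - f x))\<^sup>2) \<partial>M) + 2 * (\<integral>\<^sup>+x. ennreal ((norm (f x - g x))\<^sup>2) \<partial>M)"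
    by (rule nn_integral_norm_add_squared_le) measurable
  also have "\<dots> < 2 * ennreal (e / 4) + 2 * ennreal (e / 4)"
    using f(2) F(2) by (intro add_strict_mono ennreal_mult_strict_left_mono) auto
  also have "\<dots> = ennreal e"
    using e by (simp add: ennreal_mult_2_quarters)
  finally show "\<exists>F\<in>test_maps B. (\<integral>\<^sup>+x. ennreal ((norm (F x - g x))\<^sup>2) \<partial>M) < ennreal e"
    using F(1) by (auto intro!: bexI[of _ F])
qed

lemma L2_approximable_add:
  assumes M: "sets M = sets borel" and f: "L2_approximable M B f" and g: "L2_approximable M B g"
  shows "L2_approximable M B (\<lambda>x. f x + g x)"
  unfolding L2_approximable_def
proof (intro conjI allI impI)
  have [measurable]: "f \<in> borel_measurable M" "g \<in> borel_measurable M"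
    using f g by (auto simp: L2_approximable_def)
  show "(\<lambda>x. f x + g x) \<in> borel_measurable M" by measurable
  fix e :: real assume "e > 0"
  then have e: "e / 4 > 0" by simp
  obtain F where F: "F \<in> test_maps B" "(\<integral>\<^sup>+x. ennreal ((norm (F x - f x))\<^sup>2) \<partial>M) < ennreal (e / 4)"
    using e f unfolding L2_approximable_def by blast
  obtain G where G: "G \<in> test_maps B" "(\<integral>\<^sup>+x. ennreal ((norm (G x - g x))\<^sup>2) \<partial>M) < ennreal (e / 4)"
    using e g unfolding L2_approximable_def by blast
  have [measurable]: "F \<in> borel_measurable M" "G \<in> borel_measurable M"
    using test_maps_borel_measurable[OF F(1) M] test_maps_borel_measurable[OF G(1) M] by auto
  have "(\<integral>\<^sup>+x. ennreal ((norm (F x + G x - (f x + g x)))\<^sup>2) \<partial>M) = (\<integral>\<^sup>+x. ennreal ((norm ((F x - f x) + (G x - g x)))\<^sup>2) \<partial>M)"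
    by (simp add: algebra_simps)
  also have "\<dots> \<le> 2 * (\<integral>\<^sup>+x. ennreal ((norm (F x - f x))\<^sup>2) \<partial>M) + 2 * (\<integral>\<^sup>+x. ennreal ((norm (G x - g x))\<^sup>2) \<partial>M)"
    by (rule nn_integral_norm_add_squared_le) measurable
  also have "\<dots> < 2 * ennreal (e / 4) + 2 * ennreal (e / 4)"
    using G(2) F(2) by (intro add_strict_mono ennreal_mult_strict_left_mono) auto
  also have "\<dots> = ennreal e"
    using e by (simp add: ennreal_mult_2_quarters)
  finally show "\<exists>F\<in>test_maps B. (\<integral>\<^sup>+x. ennreal ((norm (F x - (f x + g x)))\<^sup>2) \<partial>M) < ennreal e"
    using test_maps_add[OF F(1) G(1)] by (auto intro!: bexI[of _ "\<lambda>x. F x + G x"])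
qed

text \<open>The squared error is at most \<open>(2 * w x)^2\<close>, so dominated convergence sends
  the distances to 0 and \<open>L2_approximable_closure\<close> applies.\<close>

lemma L2_approximable_dominated:
  fixes g :: "'a::euclidean_space \<Rightarrow> 'b::euclidean_space"
  assumes M: "sets M = sets borel" and f: "\<And>n. L2_approximable M B (f n)"
    and lim: "\<And>x. (\<lambda>n. f n x) \<longlonglongrightarrow> g x"
    and w: "w \<in> borel_measurable M" "\<And>n x. norm (f n x) \<le> w x"
    and fin: "(\<integral>\<^sup>+x. ennreal ((w x)\<^sup>2) \<partial>M) < \<infinity>"
  shows "L2_approximable M B g"
proof (rule L2_approximable_closure[OF M])
  have f'[measurable]: "f n \<in> borel_measurable M" for n
    using f by (auto simp: L2_approximable_def)
  note w(1)[measurable]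
  show g[measurable]: "g \<in> borel_measurable M"
    by (rule borel_measurable_LIMSEQ_metric[OF f' lim])
  have gw: "norm (g x) \<le> w x" for x
    using tendsto_norm[OF lim] by (rule LIMSEQ_le_const2) (use w in auto)
  have "(\<lambda>n. \<integral>\<^sup>+x. ennreal ((norm (f n x - g x))\<^sup>2) \<partial>M) \<longlonglongrightarrow> (\<integral>\<^sup>+x. 0 \<partial>M)"
  proof (rule nn_integral_dominated_convergence[where w = "\<lambda>x. ennreal (4 * (w x)\<^sup>2)"])
    show "AE x in M. ennreal ((norm (f n x - g x))\<^sup>2) \<le> ennreal (4 * (w x)\<^sup>2)" for n
    proof (intro AE_I2 ennreal_leI)
      fix x
      have "norm (f n x - g x) \<le> 2 * w x"
        using norm_triangle_ineq4[of "f n x" "g x"] w(2)[of n x] gw[of x] by linarith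
      then have "(norm (f n x - g x))\<^sup>2 \<le> (2 * w x)\<^sup>2" by (intro power_mono) auto
      then show "(norm (f n x - g x))\<^sup>2 \<le> 4 * (w x)\<^sup>2" by (simp add: power_mult_distrib)
    qed
    show "AE x in M. (\<lambda>n. ennreal ((norm (f n x - g x))\<^sup>2)) \<longlonglongrightarrow> 0"
    proof (intro AE_I2)
      fix x
      have "(\<lambda>n. (norm (f n x - g x))\<^sup>2) \<longlonglongrightarrow> (norm (g x - g x))\<^sup>2"
        by (intro tendsto_intros lim)
      then show "(\<lambda>n. ennreal ((norm (f n x - g x))\<^sup>2)) \<longlonglongrightarrow> 0"
        using tendsto_ennrealI by fastforce
    qed
    have "(\<integral>\<^sup>+x. ennreal (4 * (w x)\<^sup>2) \<partial>M) = 4 * (\<integral>\<^sup>+x. ennreal ((w x)\<^sup>2) \<partial>M)"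
      by (simp add: ennreal_mult nn_integral_cmult)
    then show "(\<integral>\<^sup>+x. ennreal (4 * (w x)\<^sup>2) \<partial>M) < \<infinity>"
      using fin by (simp add: ennreal_mult_less_top)
  qed measurable
  then have "(\<lambda>n. \<integral>\<^sup>+x. ennreal ((norm (f n x - g x))\<^sup>2) \<partial>M) \<longlonglongrightarrow> 0" by simp
  fix e :: real assume "e > 0"
  then have "\<forall>\<^sub>F n in sequentially. (\<integral>\<^sup>+x. ennreal ((norm (f n x - g x))\<^sup>2) \<partial>M) < ennreal e"
    using \<open>_ \<longlonglongrightarrow> 0\<close> by (intro order_tendstoD) auto
  then obtain n where "(\<integral>\<^sup>+x. ennreal ((norm (f n x - g x))\<^sup>2) \<partial>M) < ennreal e"
    by (auto simp: eventually_sequentially)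
  then show "\<exists>f. L2_approximable M B f \<and> (\<integral>\<^sup>+x. ennreal ((norm (f x - g x))\<^sup>2) \<partial>M) < ennreal e"
    using f by blast
qed

text \<open>A Dynkin argument with the open sets as intersection-stable generator: open sets come
  from bumps, complements by subtraction from \<open>B\<close>, countable disjoint unions by
  dominated convergence. Constants are square integrable dominators since the measure is
  finite.\<close>

lemma L2_approximable_indicator:
  fixes c :: "'b::euclidean_space" and B :: "'a::euclidean_space set"
  assumes "finite_measure M" and M: "sets M = sets borel" and B: "open B" and A: "A \<in> sets borel"
  shows "L2_approximable M B (\<lambda>x. indicator (A \<inter> B) x *\<^sub>R c)"
proof -
  interpret finite_measure M by fact
  have const: "(\<integral>\<^sup>+x. ennreal ((norm c)\<^sup>2) \<partial>M) < \<infinity>" for c :: 'b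
    by (simp add: ennreal_mult_eq_top_iff less_top[symmetric])
  have op: "L2_approximable M B (\<lambda>x. indicator (W \<inter> B) x *\<^sub>R c)" if "open W" for W and c :: 'b
  proof -
    have "open (W \<inter> B)" using that B by auto
    then obtain h :: "nat \<Rightarrow> 'a \<Rightarrow> real" where h: "\<And>n. h n \<in> test_maps (W \<inter> B)" "\<And>n x. \<bar>h n x\<bar> \<le> 1"
      "\<And>x. (\<lambda>n. h n x) \<longlonglongrightarrow> indicator (W \<inter> B) x"
      by (rule indicator_open_limit_test_maps) blast
    show ?thesis
    proof (rule L2_approximable_dominated[OF M _ _ _ _ const[of c]])
      have "h n \<in> test_maps B" for n using h(1)[of n] by (auto simp: test_maps_def)
      then show "L2_approximable M B (\<lambda>x. h n x *\<^sub>R c)" for n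
        by (intro L2_approximable_test_maps test_maps_scaleR M)
      show "(\<lambda>n. h n x *\<^sub>R c) \<longlonglongrightarrow> indicator (W \<inter> B) x *\<^sub>R c" for x
        by (intro tendsto_intros h)
      show "norm (h n x *\<^sub>R c) \<le> norm c" for n x
        using mult_right_mono[OF h(2)[of n x] norm_ge_zero[of c]] by simp
    qed auto
  qed
  have "Int_stable (Collect open :: 'a set set)" by (auto simp: Int_stable_def)
  moreover have "Collect open \<subseteq> Pow (UNIV :: 'a set)" by auto
  moreover have "A \<in> sigma_sets UNIV (Collect open)" using A by (simp add: borel_def)
  \<comment> \<open>The vector is quantified inside the induction because the complement case uses
    the hypothesis for \<open>- c\<close>.\<close>
  ultimately have "\<forall>c. L2_approximable M B (\<lambda>x. indicator (A \<inter> B) x *\<^sub>R (c::'b))"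
  proof (induction rule: sigma_sets_induct_disjoint)
    case (basic A)
    then show ?case using op by auto
  next
    case empty
    then show ?case by (simp add: L2_approximable_zero)
  next
    case (compl A)
    show ?case
    proof
      fix c :: 'b
      have "L2_approximable M B (\<lambda>x. indicator (UNIV \<inter> B) x *\<^sub>R c + indicator (A \<inter> B) x *\<^sub>R (- c))"
        by (rule L2_approximable_add[OF M op[OF open_UNIV] compl(2)[rule_format]])
      also have "(\<lambda>x. indicator (UNIV \<inter> B) x *\<^sub>R c + indicator (A \<inter> B) x *\<^sub>R (- c))
          = (\<lambda>x. indicator ((UNIV - A) \<inter> B) x *\<^sub>R c)"
        by (auto simp: fun_eq_iff indicator_def)
      finally show "L2_approximable M B (\<lambda>x. indicator ((UNIV - A) \<inter> B) x *\<^sub>R c)" .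
    qed
  next
    case (union A)
    show ?case
    proof
      fix c :: 'b
      show "L2_approximable M B (\<lambda>x. indicator ((\<Union>i. A i) \<inter> B) x *\<^sub>R c)"
      proof (rule L2_approximable_dominated[OF M _ _ _ _ const[of c]])
        show "L2_approximable M B (\<lambda>x. indicator ((\<Union>i<n. A i) \<inter> B) x *\<^sub>R c)" for n
        proof (induction n)
          case 0
          then show ?case by (simp add: L2_approximable_zero)
        next
          case (Suc n)
          have "L2_approximable M B (\<lambda>x. indicator ((\<Union>i<n. A i) \<inter> B) x *\<^sub>R c + indicator (A n \<inter> B) x *\<^sub>R c)"
            by (rule L2_approximable_add[OF M Suc union(3)[rule_format]])
          also have "(\<lambda>x. indicator ((\<Union>i<n. A i) \<inter> B) x *\<^sub>R c + indicator (A n \<inter> B) x *\<^sub>R c)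
              = (\<lambda>x. indicator ((\<Union>i<Suc n. A i) \<inter> B) x *\<^sub>R c)"
          proof
            fix x
            \<comment> \<open>Disjointness ensures that adding the two indicators counts no point
              twice.\<close>
            have "x \<notin> A i" if "x \<in> A n" "i < n" for i
              using disjoint_family_onD[OF union(1), of i n] that by auto
            then show "indicator ((\<Union>i<n. A i) \<inter> B) x *\<^sub>R c + indicator (A n \<inter> B) x *\<^sub>R c
                = indicator ((\<Union>i<Suc n. A i) \<inter> B) x *\<^sub>R c"
              by (cases "x \<in> A n") (auto simp: indicator_def less_Suc_eq)
          qed
          finally show ?case .
        qed
        show "(\<lambda>n. indicator ((\<Union>i<n. A i) \<inter> B) x *\<^sub>R c) \<longlonglongrightarrow> indicator ((\<Union>i. A i) \<inter> B) x *\<^sub>R c" for x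
        proof (cases "x \<in> (\<Union>i. A i) \<inter> B")
          case True
          then obtain i where i: "x \<in> A i" "x \<in> B" by auto
          have "\<forall>\<^sub>F n in sequentially. indicator ((\<Union>i<n. A i) \<inter> B) x *\<^sub>R c = c"
            using eventually_gt_at_top[of i] by eventually_elim (use i in \<open>auto simp: indicator_def\<close>)
          moreover have "indicator ((\<Union>i. A i) \<inter> B) x *\<^sub>R c = c"
            using True by (simp only: indicator_simps scaleR_one)
          ultimately show ?thesis by (simp only: tendsto_eventually)
        qed (auto simp: indicator_def)
        show "norm (indicator ((\<Union>i<n. A i) \<inter> B) x *\<^sub>R c) \<le> norm c" for n x
          by (auto simp: indicator_def)
      qed auto
    qed
  qed
  then show ?thesis by blast
qed

proposition L2_approximable_square_integrable:
  fixes g :: "'a::euclidean_space \<Rightarrow> 'b::euclidean_space"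
  assumes "finite_measure M" and M: "sets M = sets borel" and B: "open B"
    and g[measurable]: "g \<in> borel_measurable M" and fin: "(\<integral>\<^sup>+x. ennreal ((norm (g x))\<^sup>2) \<partial>M) < \<infinity>"
    and supp: "\<And>x. x \<notin> B \<Longrightarrow> g x = 0"
  shows "L2_approximable M B g"
proof -
  have sp: "space M = UNIV" using sets_eq_imp_space_eq[OF M] by simp
  \<comment> \<open>Taking 0 as reference point gives the bound \<open>2 * norm (g x)\<close>. It
    serves twice: as the dominating function, and to force the simple functions to vanish off
    \<open>B\<close>.\<close>
  obtain s where s: "\<And>i. simple_function M (s i)" "\<And>x. (\<lambda>i. s i x) \<longlonglongrightarrow> g x"
    "\<And>i x. norm (s i x) \<le> 2 * norm (g x)"
    using borel_measurable_implies_sequence_metric[OF g, of 0] sp by (auto simp: dist_norm)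
  show ?thesis
  proof (rule L2_approximable_dominated[OF M _ s(2) _ s(3)])
    fix i
    have s_supp: "s i x = 0" if "x \<notin> B" for x using s(3)[of i x] supp[OF that] by simp
    have sum: "L2_approximable M B (\<lambda>x. \<Sum>y\<in>S. indicator (s i -` {y} \<inter> B) x *\<^sub>R y)" if "finite S" for S
      using that
    proof (induction S rule: finite_induct)
      case (insert y S)
      have "s i -` {y} \<inter> space M \<in> sets M" using s(1) by (rule simple_functionD)
      then have "L2_approximable M B (\<lambda>x. indicator (s i -` {y} \<inter> B) x *\<^sub>R y)"
        by (intro L2_approximable_indicator assms(1) M B) (simp add: M sp)
      from L2_approximable_add[OF M this insert.IH] show ?case
        by (simp only: sum.insert[OF insert.hyps])
    qed (simp add: L2_approximable_zero)
    have "(\<Sum>y\<in>s i ` UNIV. indicator (s i -` {y} \<inter> B) x *\<^sub>R y) = s i x" for x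
    proof (cases "x \<in> B")
      case True
      then show ?thesis
        using simple_function_indicator_representation_banach[OF s(1)[of i], of x]
        by (simp add: sp indicator_def)
    qed (simp add: s_supp)
    then show "L2_approximable M B (s i)"
      using sum[of "s i ` UNIV"] simple_functionD(1)[OF s(1)[of i]] by (simp add: sp)
  next
    have "(\<integral>\<^sup>+x. ennreal ((2 * norm (g x))\<^sup>2) \<partial>M) = 4 * (\<integral>\<^sup>+x. ennreal ((norm (g x))\<^sup>2) \<partial>M)"
      by (simp add: power_mult_distrib ennreal_mult nn_integral_cmult)
    then show "(\<integral>\<^sup>+x. ennreal ((2 * norm (g x))\<^sup>2) \<partial>M) < \<infinity>"
      using fin by (simp add: ennreal_mult_less_top)
  qed measurable
qed

section \<open>Scores and Stein's identity\<close>

text \<open>The derivative is represented by its adjoint applied to 1; uniqueness of derivatives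
  makes this the only candidate, so the definite description in \<open>gradient\<close> is
  meaningful.\<close>

lemma has_derivative_gradient:
  fixes f :: "'a::euclidean_space \<Rightarrow> real"
  assumes "f differentiable (at x)"
  shows "(f has_derivative (\<lambda>h. h \<bullet> gradient f x)) (at x)"
proof -
  obtain f' where f': "(f has_derivative f') (at x)" using assms by (auto simp: differentiable_def)
  then have "linear f'" by (rule has_derivative_linear)
  then have "f' = (\<lambda>h. h \<bullet> adjoint f' 1)" by (simp add: adjoint_works fun_eq_iff)
  with f' have D: "GDERIV f x :> adjoint f' 1" by (simp add: gderiv_def)
  have "GDERIV f x :> gradient f x"
    unfolding gradient_def
  proof (rule theI[where P = "\<lambda>D. GDERIV f x :> D", OF D])
    fix D' assume "GDERIV f x :> D'"
    then have "(\<lambda>h. h \<bullet> D') = (\<lambda>h. h \<bullet> adjoint f' 1)"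
      using D unfolding gderiv_def by (rule has_derivative_unique)
    then show "D' = adjoint f' 1" by (metis vector_eq_ldot)
  qed
  then show ?thesis by (simp add: gderiv_def)
qed

context
  fixes p :: "real^'m \<Rightarrow> real"
  assumes p: "smooth_density p"
begin

lemma smooth_density_pos: "p x > 0"
  using p by (simp add: smooth_density_def)

lemma smooth_density_differentiable: "p differentiable (at x)"
  using p by (simp add: smooth_density_def differentiable_on_def)

lemma smooth_density_continuous: "continuous_on UNIV p"
  using p by (simp add: smooth_density_def differentiable_imp_continuous_on)

lemma smooth_density_measurable: "p \<in> borel_measurable borel"
  by (rule borel_measurable_continuous_onI[OF smooth_density_continuous])

lemma ln_density_has_derivative:
  "((\<lambda>x. ln (p x)) has_derivative (\<lambda>h. h \<bullet> score p x)) (at x)"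
  unfolding score_def
proof (rule has_derivative_gradient)
  obtain p' where "(p has_derivative p') (at x)"
    using smooth_density_differentiable by (auto simp: differentiable_def)
  from has_derivative_ln[OF smooth_density_pos this] show "(\<lambda>x. ln (p x)) differentiable (at x)"
    by (auto simp: differentiable_def)
qed

lemma density_has_derivative:
  "(p has_derivative (\<lambda>h. p x * (h \<bullet> score p x))) (at x)"
proof -
  have "((\<lambda>x. exp (ln (p x))) has_derivative (\<lambda>h. p x * (h \<bullet> score p x))) (at x)"
    using has_derivative_exp[OF ln_density_has_derivative, of x] smooth_density_pos by (simp add: mult.commute)
  then show ?thesis using smooth_density_pos by simp
qed

text \<open>The approximants are the difference quotients of \<open>ln (p x)\<close> along the basis
  vectors. The score itself may be discontinuous; this representation yields its measurability and
  feeds the Baire argument.\<close>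

lemma score_limit_continuous:
  obtains D :: "nat \<Rightarrow> real^'m \<Rightarrow> real^'m"
  where "\<And>n. continuous_on UNIV (D n)" "\<And>x. (\<lambda>n. D n x) \<longlonglongrightarrow> score p x"
proof
  define D :: "nat \<Rightarrow> real^'m \<Rightarrow> real^'m" where
    "D n x = (\<Sum>b\<in>Basis. (real (Suc n) * (ln (p (x + inverse (real (Suc n)) *\<^sub>R b)) - ln (p x))) *\<^sub>R b)" for n x
  have pos: "p y \<noteq> 0" for y using smooth_density_pos[of y] by simp
  have shift: "continuous_on UNIV (\<lambda>x. p (x + v))" for v
    by (rule continuous_on_compose2[OF smooth_density_continuous]) (auto intro!: continuous_intros)
  show "continuous_on UNIV (D n)" for n
    unfolding D_def[abs_def] by (intro continuous_intros shift smooth_density_continuous) (use pos in auto)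
  show "(\<lambda>n. D n x) \<longlonglongrightarrow> score p x" for x
  proof -
    have "(\<lambda>n. D n x) \<longlonglongrightarrow> (\<Sum>b\<in>Basis. (b \<bullet> score p x) *\<^sub>R b)"
      unfolding D_def
      by (intro tendsto_sum tendsto_scaleR tendsto_const
          difference_quotient_tendsto[OF ln_density_has_derivative])
    then show ?thesis by (simp add: inner_commute[of _ "score p x"] euclidean_representation)
  qed
qed

lemma score_measurable: "score p \<in> borel_measurable borel"
proof -
  obtain D :: "nat \<Rightarrow> real^'m \<Rightarrow> real^'m"
    where D: "\<And>n. continuous_on UNIV (D n)" "\<And>x. (\<lambda>n. D n x) \<longlonglongrightarrow> score p x"
    by (rule score_limit_continuous) blast
  have "D n \<in> borel_measurable borel" for n using D(1) by (rule borel_measurable_continuous_onI)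
  then show ?thesis using D(2) by (rule borel_measurable_LIMSEQ_metric)
qed

section \<open>The probability measure of a density and Stein's identity for it\<close>

lemma sets_distr_of: "sets (distr_of p) = sets borel"
  by (simp add: distr_of_def)

lemma distr_of_finite: "finite_measure (distr_of p)"
proof
  have "(\<integral>\<^sup>+x. ennreal (p x) \<partial>lborel) = ennreal 1"
  proof -
    have "has_bochner_integral lborel p 1" using p by (simp add: smooth_density_def)
    then show ?thesis
      using smooth_density_pos
      by (subst nn_integral_eq_integral) (auto simp: has_bochner_integral_iff intro: less_imp_le)
  qed
  then show "emeasure (distr_of p) (space (distr_of p)) \<noteq> \<infinity>"
    using smooth_density_measurable by (simp add: distr_of_def emeasure_density)
qed

lemma nn_integral_distr_of:
  assumes "f \<in> borel_measurable borel"
  shows "(\<integral>\<^sup>+x. f x \<partial>distr_of p) = (\<integral>\<^sup>+x. ennreal (p x) * f x \<partial>lborel)"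
  unfolding distr_of_def by (rule nn_integral_density) (use assms smooth_density_measurable in simp_all)

text \<open>Testing with \<open>F / p\<close> gives \<open>p \<cdot> \<A>\<^sub>p (F / p) = div F\<close>, so Stein's identity holds although
  the score need not be locally integrable.\<close>

lemma stein_op_divide_density:
  assumes F: "(F has_derivative F') (at x)"
  shows "stein_op p (\<lambda>x. (1 / p x) *\<^sub>R F x) x = (\<Sum>i\<in>UNIV. F' (axis i 1) $ i) / p x"
proof -
  let ?s = "score p x"
  have p0: "p x \<noteq> 0" using smooth_density_pos[of x] by simp
  have "((\<lambda>x. (1 / p x) *\<^sub>R F x) has_derivative
      (\<lambda>h. (1 / p x) *\<^sub>R F' h - ((h \<bullet> ?s) / p x) *\<^sub>R F x)) (at x)"
    using p0 by (auto intro!: derivative_eq_intros F density_has_derivative simp: fun_eq_iff field_simps)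
  from frechet_derivative_at[OF this, symmetric]
  have "trace (jacobian (\<lambda>x. (1 / p x) *\<^sub>R F x) (at x)) =
      (\<Sum>i\<in>UNIV. (F' (axis i 1) $ i) / p x - (?s $ i * F x $ i) / p x)"
    by (simp add: jacobian_def trace_def matrix_def inner_axis' )
  moreover have "?s \<bullet> ((1 / p x) *\<^sub>R F x) = (\<Sum>i\<in>UNIV. (?s $ i * F x $ i) / p x)"
    by (simp add: inner_vec_def sum_divide_distrib)
  ultimately show ?thesis
    by (simp add: stein_op_def sum_subtractf sum_divide_distrib)
qed

lemma stein_identity_divide_density:
  assumes F: "F \<in> test_maps B" and B: "bounded B"
  shows "has_bochner_integral (distr_of p) (stein_op p (\<lambda>x. (1 / p x) *\<^sub>R F x)) 0"
proof -
  let ?A = "stein_op p (\<lambda>x. (1 / p x) *\<^sub>R F x)"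
  define F' where "F' x = frechet_derivative F (at x)" for x
  have F': "(F has_derivative F' x) (at x)" for x
    using F by (simp add: test_maps_def F'_def frechet_derivative_works[symmetric])
  obtain L where L: "L-lipschitz_on UNIV F" using F by (auto simp: test_maps_def)
  \<comment> \<open>Only the diagonal partial derivatives enter the divergence; each is a
    directional derivative of a Lipschitz coordinate function vanishing off the bounded set
    \<open>B\<close>.\<close>
  have "has_bochner_integral lborel (\<lambda>x. F' x (axis i 1) $ i) 0" for i
  proof (rule integral_directional_derivative_eq_0[OF _ _ B])
    show "((\<lambda>x. F x $ i) has_derivative (\<lambda>h. F' x h $ i)) (at x)" for x
      using bounded_linear_vec_nth F' by (rule bounded_linear.has_derivative)
    show "L-lipschitz_on UNIV (\<lambda>x. F x $ i)"
    proof (rule lipschitz_onI)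
      show "dist (F x $ i) (F y $ i) \<le> L * dist x y" for x y
        using dist_vec_nth_le[of "F x" i "F y"] lipschitz_onD[OF L, of x y] by simp
    qed (rule lipschitz_on_nonneg[OF L])
    show "F x $ i = 0" if "x \<notin> B" for x using F that by (simp add: test_maps_def)
  qed
  then have "has_bochner_integral lborel (\<lambda>x. \<Sum>i\<in>UNIV. F' x (axis i 1) $ i) (\<Sum>i\<in>(UNIV::'m set). 0)"
    by (rule has_bochner_integral_sum)
  moreover have pA: "p x *\<^sub>R ?A x = (\<Sum>i\<in>UNIV. F' x (axis i 1) $ i)" for x
    using stein_op_divide_density[OF F'] smooth_density_pos[of x] by simp
  ultimately have int: "has_bochner_integral lborel (\<lambda>x. p x *\<^sub>R ?A x) 0" by simp
  \<comment> \<open>Measurability of the Stein term is recovered from that of its product with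
    \<open>p\<close>, by dividing by the positive density.\<close>
  then have "(\<lambda>x. p x *\<^sub>R ?A x) \<in> borel_measurable borel"
    using borel_measurable_has_bochner_integral by fastforce
  then have "(\<lambda>x. (p x *\<^sub>R ?A x) / p x) \<in> borel_measurable borel"
    using smooth_density_measurable by (rule borel_measurable_divide)
  moreover have "(p x *\<^sub>R ?A x) / p x = ?A x" for x using smooth_density_pos[of x] by simp
  ultimately have meas: "?A \<in> borel_measurable borel" by simp
  show ?thesis
    unfolding distr_of_def
    by (rule has_bochner_integral_density[OF _ _ _ int])
       (use meas smooth_density_measurable smooth_density_pos in \<open>auto intro: less_imp_le\<close>)
qed

end

section \<open>Local square integrability of pointwise limits\<close>

text \<open>A convergent sequence is bounded, so the closed sets \<open>E n\<close> of points where
  all \<open>D k\<close> are bounded by \<open>n\<close> cover the space. By Baire one of them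
  contains a relatively open piece of \<open>C\<close>, and the bound passes to the limit.\<close>

lemma pointwise_limit_locally_bounded:
  fixes g :: "'a::euclidean_space \<Rightarrow> 'b::real_normed_vector"
  assumes D: "\<And>n. continuous_on UNIV (D n)" and lim: "\<And>x. (\<lambda>n. D n x) \<longlonglongrightarrow> g x"
    and C: "closed C" "C \<noteq> {}"
  obtains x r K where "x \<in> C" "r > 0" "\<And>y. y \<in> C \<Longrightarrow> y \<in> ball x r \<Longrightarrow> norm (g y) \<le> K"
proof -
  define E where "E n = {x. \<forall>k. norm (D k x) \<le> real n}" for n
  have clE: "closed (E n)" for n
    unfolding E_def using D by (intro closed_Collect_all closed_Collect_le continuous_intros)
  have cover: "\<exists>n. x \<in> E n" for x
  proof -
    obtain K where "\<And>k. norm (D k x) \<le> K"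
      using convergent_imp_Bseq[OF convergentI[OF lim[of x]]] unfolding Bseq_def by blast
    moreover obtain n where "K \<le> real n" using real_arch_simple by blast
    ultimately have "x \<in> E n" unfolding E_def using order_trans by blast
    then show ?thesis ..
  qed
  \<comment> \<open>Otherwise every \<open>C - E n\<close> would be relatively open and dense in
    \<open>C\<close>, although their intersection is empty.\<close>
  have "\<exists>n. \<not> C \<subseteq> closure (C - E n)"
  proof (rule ccontr)
    assume "\<not> ?thesis"
    then have dense: "C \<subseteq> closure (C - E n)" for n by blast
    have "C \<subseteq> closure (\<Inter>(range (\<lambda>n. C - E n)))"
    proof (rule Baire[OF C(1)])
      fix T assume "T \<in> range (\<lambda>n. C - E n)"
      then obtain n where T: "T = C - E n" by blast
      have "C - E n = C \<inter> - E n" by blast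
      then have "openin (top_of_set C) (C - E n)"
        using clE[of n] by (metis open_Compl openin_open_Int)
      then show "openin (top_of_set C) T \<and> C \<subseteq> closure T" using T dense by blast
    qed simp
    moreover have "\<Inter>(range (\<lambda>n. C - E n)) = {}" using cover by blast
    ultimately show False using C(2) by (simp only: closure_empty subset_empty)
  qed
  then obtain n x where x: "x \<in> C" "x \<notin> closure (C - E n)" by blast
  have "open (- closure (C - E n))" "x \<in> - closure (C - E n)"
    using x(2) by (simp_all only: open_Compl closed_closure Compl_iff not_False_eq_True)
  then obtain r where r: "r > 0" "ball x r \<subseteq> - closure (C - E n)"
    by (rule openE)
  show thesis
  proof (rule that[OF x(1) r(1)])
    fix y assume "y \<in> C" "y \<in> ball x r"
    then have "y \<in> E n" using r(2) closure_subset[of "C - E n"] by blast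
    then have "\<And>k. norm (D k y) \<le> real n" by (simp add: E_def)
    then show "norm (g y) \<le> real n" by (intro LIMSEQ_le_const2[OF tendsto_norm[OF lim]]) auto
  qed
qed

text \<open>A pointwise limit of continuous functions may fail to be locally square integrable on a set
  of positive measure. By Baire it is bounded on a relatively open part of the closed set where
  it fails, so the square integral already diverges on the complement of this set.\<close>

lemma square_integral_exhaustion:
  fixes g :: "'a::euclidean_space \<Rightarrow> 'b::euclidean_space"
  assumes "finite_measure M" and M: "sets M = sets borel"
    and D: "\<And>n. continuous_on UNIV (D n)" and lim: "\<And>x. (\<lambda>n. D n x) \<longlonglongrightarrow> g x"
  defines "N \<equiv> density M (\<lambda>x. ennreal ((norm (g x))\<^sup>2))"
  obtains B :: "nat \<Rightarrow> 'a set" where "\<And>n. open (B n)" "\<And>n. bounded (B n)" "\<And>n. emeasure N (B n) < \<infinity>"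
    "(SUP n. emeasure N (B n)) = emeasure N UNIV"
proof -
  interpret finite_measure M by fact
  have D': "D n \<in> borel_measurable borel" for n using D by (rule borel_measurable_continuous_onI)
  have "g \<in> borel_measurable borel" by (rule borel_measurable_LIMSEQ_metric[OF D' lim])
  then have g[measurable]: "g \<in> borel_measurable M" using M by (simp cong: measurable_cong_sets)
  have N: "sets N = sets borel" by (simp add: N_def M)
  have [simp]: "S \<in> sets N" if "open S" for S using that by (simp add: N)
  \<comment> \<open>The union \<open>U\<close> of this family consists of the points having a
    neighbourhood of finite \<open>N\<close>-mass. Lindelof reduces it to a countable family, whose
    finite unions \<open>B n\<close> still have finite mass by subadditivity.\<close>
  define \<F> where "\<F> = {V :: 'a set. open V \<and> bounded V \<and> emeasure N V < \<infinity>}"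
  define U where "U = \<Union>\<F>"
  have U: "open U" by (auto simp: U_def \<F>_def)
  obtain \<F>' where F': "\<F>' \<subseteq> \<F>" "countable \<F>'" "\<Union>\<F>' = \<Union>\<F>"
    by (rule Lindelof[of \<F>]) (auto simp: \<F>_def)
  define V where "V = from_nat_into (insert {} \<F>')"
  have ran: "range V = insert {} \<F>'"
    unfolding V_def using F'(2) by (intro range_from_nat_into) auto
  have VF: "V k \<in> \<F>" for k
  proof -
    have "{} \<in> \<F>" by (simp add: \<F>_def)
    then have "range V \<subseteq> \<F>" unfolding ran using F'(1) by simp
    then show ?thesis by (rule subsetD) (rule rangeI)
  qed
  have V: "open (V k)" "bounded (V k)" "emeasure N (V k) < \<infinity>" for k
    using VF[of k] by (simp_all add: \<F>_def)
  have UV: "(\<Union>k. V k) = U" using F'(3) by (simp add: ran U_def)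
  define B where "B n = (\<Union>k<n. V k)" for n
  have B: "open (B n)" "bounded (B n)" for n
    unfolding B_def using V by auto
  have UB: "(\<Union>n. B n) = U"
  proof
    show "(\<Union>n. B n) \<subseteq> U" unfolding B_def UV[symmetric] by blast
    have "V k \<subseteq> B (Suc k)" for k by (auto simp: B_def)
    then show "U \<subseteq> (\<Union>n. B n)" unfolding UV[symmetric] by blast
  qed
  have fin: "emeasure N (B n) < \<infinity>" for n
  proof (induction n)
    case (Suc n)
    have "B (Suc n) = V n \<union> B n" by (simp add: B_def lessThan_Suc)
    then have "emeasure N (B (Suc n)) \<le> emeasure N (V n) + emeasure N (B n)"
      using emeasure_subadditive[of "V n" N "B n"] V B by simp
    also have "\<dots> < \<infinity>" using Suc V(3)[of n] by simp
    finally show ?case .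
  qed (simp add: B_def)
  have "incseq B" unfolding B_def by (intro monoI UN_mono) auto
  then have sup: "(SUP n. emeasure N (B n)) = emeasure N U"
    using SUP_emeasure_incseq[of B N] B by (simp add: UB image_subset_iff)
  have "emeasure N U = emeasure N UNIV"
  proof (cases "- U = {}")
    case True
    then have "U = UNIV" by (metis Compl_empty_eq double_complement)
    then show ?thesis by simp
  next
    case False
    have "closed (- U)" using U by (simp add: closed_Compl)
    then obtain x r K where x: "x \<in> - U" "r > 0" and K: "\<And>y. y \<in> - U \<Longrightarrow> y \<in> ball x r \<Longrightarrow> norm (g y) \<le> K"
      using pointwise_limit_locally_bounded[OF D lim _ False] by metis
    have mB: "ball x r - U \<in> sets N" using U by (auto simp: N)
    have "emeasure N (ball x r - U) = (\<integral>\<^sup>+y. ennreal ((norm (g y))\<^sup>2) * indicator (ball x r - U) y \<partial>M)"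
      unfolding N_def using mB by (intro emeasure_density) (auto simp: M N)
    also have "\<dots> \<le> (\<integral>\<^sup>+y. ennreal (K\<^sup>2) \<partial>M)"
    proof (rule nn_integral_mono)
      fix y
      show "ennreal ((norm (g y))\<^sup>2) * indicator (ball x r - U) y \<le> ennreal (K\<^sup>2)"
        using K[of y] by (auto simp: indicator_def intro!: ennreal_leI power_mono)
    qed
    also have "\<dots> < \<infinity>" by (simp add: ennreal_mult_eq_top_iff less_top[symmetric])
    finally have out: "emeasure N (ball x r - U) < \<infinity>" .
    \<comment> \<open>If \<open>U\<close> had finite mass, so would the ball around
      \<open>x\<close>, because its part outside \<open>U\<close> has finite mass by boundedness of
      \<open>g\<close> there. The ball would then belong to the family, putting \<open>x\<close>
      into \<open>U\<close>.\<close>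
    have "emeasure N U = \<infinity>"
    proof (rule ccontr)
      assume "emeasure N U \<noteq> \<infinity>"
      then have fU: "emeasure N U < \<infinity>" by (simp add: less_top)
      have "emeasure N (ball x r) \<le> emeasure N (U \<union> (ball x r - U))"
        using U mB by (intro emeasure_mono) auto
      also have "\<dots> \<le> emeasure N U + emeasure N (ball x r - U)"
        using U mB by (intro emeasure_subadditive) auto
      also have "\<dots> < \<infinity>" using out fU by simp
      finally have "ball x r \<in> \<F>" by (simp add: \<F>_def)
      then have "x \<in> U" unfolding U_def by (rule UnionI) (use x(2) in simp)
      then show False using x(1) by simp
    qed
    moreover have "emeasure N U \<le> emeasure N UNIV"
      by (rule emeasure_mono[OF subset_UNIV]) simp
    ultimately show ?thesis by (simp only: infinity_ennreal_def top_unique)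
  qed
  then show thesis using that[of B] B fin sup by simp
qed

section \<open>The optimal loss\<close>

context
  fixes q p :: "real^'m \<Rightarrow> real" and lam :: real
  assumes q: "smooth_density q" and p: "smooth_density p" and lam: "lam > 0"
begin

section \<open>Reduction to the score difference and the upper bound\<close>

abbreviation score_diff :: "real^'m \<Rightarrow> real^'m" where
  "score_diff x \<equiv> score p x - score q x"

lemma score_diff_measurable: "score_diff \<in> borel_measurable borel"
  using score_measurable[OF p] score_measurable[OF q] by (rule borel_measurable_diff)

lemma measurable_distr_of: "f \<in> borel_measurable borel \<Longrightarrow> f \<in> borel_measurable (distr_of q)"
  using sets_distr_of[OF q] by (simp cong: measurable_cong_sets)

lemma fisher_div_eq: "fisher_div q p = (\<integral>\<^sup>+x. ennreal ((norm (score_diff x))\<^sup>2) \<partial>distr_of q)"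
proof -
  note score_diff_measurable[measurable]
  have "(\<integral>\<^sup>+x. ennreal ((norm (score_diff x))\<^sup>2) \<partial>distr_of q)
      = (\<integral>\<^sup>+x. ennreal (q x) * ennreal ((norm (score_diff x))\<^sup>2) \<partial>lborel)"
    by (rule nn_integral_distr_of[OF q]) measurable
  also have "\<dots> = fisher_div q p"
    unfolding fisher_div_def
    by (intro nn_integral_cong)
       (simp add: norm_minus_commute[of "score q _"] mult.commute less_imp_le[OF smooth_density_pos[OF q]]
         flip: ennreal_mult)
  finally show ?thesis by simp
qed

text \<open>Subtracting the vanishing expectation of the Stein term of \<open>q\<close> cancels the
  traces. Integrability of the inner product is inherited from the two Stein terms, so it is
  available even when the score difference is not square integrable.\<close>

lemma RSD_eq:
  assumes \<phi>: "\<phi> \<in> admissible q p"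
  shows "integrable (distr_of q) (\<lambda>x. score_diff x \<bullet> \<phi> x - lam * (norm (\<phi> x))\<^sup>2)" (is "integrable _ ?f")
    and "RSD lam q p \<phi> = (LINT x|distr_of q. score_diff x \<bullet> \<phi> x - lam * (norm (\<phi> x))\<^sup>2)"
proof -
  let ?Q = "distr_of q"
  have sq: "integrable ?Q (\<lambda>x. (norm (\<phi> x))\<^sup>2)" and sp: "integrable ?Q (stein_op p \<phi>)"
    and sQ: "integrable ?Q (stein_op q \<phi>)" and s0: "(LINT x|?Q. stein_op q \<phi> x) = 0"
    using \<phi> by (auto simp: admissible_def has_bochner_integral_iff)
  have diff: "score_diff x \<bullet> \<phi> x = stein_op p \<phi> x - stein_op q \<phi> x" for x
    by (simp add: stein_op_def inner_diff_left)
  show "integrable ?Q ?f" unfolding diff using sq sp sQ by simp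
  have "(LINT x|?Q. ?f x) = (LINT x|?Q. stein_op p \<phi> x) - lam * (LINT x|?Q. (norm (\<phi> x))\<^sup>2)"
    unfolding diff using sq sp sQ s0 by simp
  then show "RSD lam q p \<phi> = (LINT x|?Q. ?f x)"
    by (simp add: RSD_def power2_norm_eq_inner)
qed

lemma complete_square:
  fixes u v :: "real^'m"
  shows "u \<bullet> v - lam * (norm v)\<^sup>2 = (norm u)\<^sup>2 / (4 * lam) - lam * (norm (v - (1 / (2 * lam)) *\<^sub>R u))\<^sup>2"
  using lam by (simp add: power2_norm_eq_inner inner_diff_left inner_diff_right inner_commute field_simps)

lemma RSD_le_fisher_div:
  assumes \<phi>: "\<phi> \<in> admissible q p"
  shows "ereal (RSD lam q p \<phi>) \<le> ereal (1 / (4 * lam)) * enn2ereal (fisher_div q p)"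
proof (cases "fisher_div q p")
  case top
  then show ?thesis using lam by simp
next
  case (real r)
  let ?Q = "distr_of q"
  note measurable_distr_of[OF score_diff_measurable, measurable]
  have int: "integrable ?Q (\<lambda>x. (norm (score_diff x))\<^sup>2)"
    by (rule integrableI_bounded) (use real in \<open>auto simp: fisher_div_eq\<close>)
  have "ennreal (LINT x|?Q. (norm (score_diff x))\<^sup>2) = ennreal r"
    using nn_integral_eq_integral[OF int] real by (simp add: fisher_div_eq)
  then have r: "(LINT x|?Q. (norm (score_diff x))\<^sup>2) = r" using real by simp
  \<comment> \<open>After completing the square, the subtracted term is nonnegative and is
    dropped.\<close>
  have "RSD lam q p \<phi> \<le> (LINT x|?Q. (norm (score_diff x))\<^sup>2 / (4 * lam))"
    unfolding RSD_eq(2)[OF \<phi>]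
    by (rule integral_mono[OF RSD_eq(1)[OF \<phi>]]) (use int lam in \<open>simp_all add: complete_square\<close>)
  also have "\<dots> = 1 / (4 * lam) * r" by (simp add: r)
  finally show ?thesis using real by (simp add: enn2ereal_ennreal)
qed

section \<open>The lower bound by nearly optimal discriminators\<close>

lemma density_divide_finite:
  assumes "bounded B" "B \<in> sets borel"
  shows "finite_measure (density lborel (\<lambda>x. ennreal (indicator B x / q x)))" (is "finite_measure ?N")
proof
  note smooth_density_measurable[OF q, measurable] assms(2)[measurable]
  obtain a where "\<And>x. x \<in> B \<Longrightarrow> norm x \<le> a" using assms(1) by (auto simp: bounded_iff)
  then have a: "B \<subseteq> cball 0 a" by auto
  \<comment> \<open>The reciprocal of a positive continuous density is continuous, hence integrable
    over the compact ball containing \<open>B\<close>.\<close>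
  have "integrable lborel (\<lambda>x. indicator (cball 0 a) x *\<^sub>R (1 / q x))"
    by (rule borel_integrable_compact)
       (use smooth_density_pos[OF q] in \<open>auto intro!: continuous_intros
         continuous_on_subset[OF smooth_density_continuous[OF q]] simp: less_le\<close>)
  then have "integrable lborel (\<lambda>x. indicator B x / q x)"
  proof (rule Bochner_Integration.integrable_bound)
    show "AE x in lborel. norm (indicator B x / q x) \<le> norm (indicator (cball 0 a) x *\<^sub>R (1 / q x))"
      by (rule AE_I2) (use a in \<open>auto simp: indicator_def\<close>)
  qed measurable
  then have "(\<integral>\<^sup>+x. ennreal (indicator B x / q x) \<partial>lborel) < \<infinity>"
    using less_imp_le[OF smooth_density_pos[OF q]] by (subst nn_integral_eq_integral) auto
  then show "emeasure ?N (space ?N) \<noteq> \<infinity>" by (simp add: emeasure_density)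
qed

text \<open>On \<open>B\<close> the formal optimum \<open>u / (2 * lam)\<close> is square integrable
  and is approximated by \<open>F / q\<close> with \<open>F\<close> a test map. By the completed
  square, a squared error of at most \<open>e\<close> costs at most \<open>lam * e\<close>.\<close>

lemma RSD_approximates:
  assumes B: "open B" "bounded B"
    and fin: "(\<integral>\<^sup>+x. ennreal ((norm (indicator B x *\<^sub>R score_diff x))\<^sup>2) \<partial>distr_of q) = ennreal r" and r: "r \<ge> 0"
    and e: "e > 0"
  shows "\<exists>\<phi>\<in>admissible q p. RSD lam q p \<phi> \<ge> r / (4 * lam) - lam * e"
proof -
  let ?Q = "distr_of q"
  note smooth_density_measurable[OF q, measurable] score_diff_measurable[measurable] sets_distr_of[OF q, measurable_cong]
  have [measurable]: "B \<in> sets borel" using B by simp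
  note pos = smooth_density_pos[OF q]
  define u where "u x = indicator B x *\<^sub>R score_diff x" for x
  have [measurable]: "u \<in> borel_measurable borel" unfolding u_def[abs_def] by measurable
  \<comment> \<open>The weight \<open>1 / q\<close> converts distances: for fields vanishing off
    \<open>B\<close>, the squared norm of \<open>f\<close> under \<open>N\<close> equals that of
    \<open>f / q\<close> under the law of \<open>q\<close>. The target \<open>g\<close> is therefore
    \<open>q\<close> times the formal optimum.\<close>
  define N where "N = density lborel (\<lambda>x. ennreal (indicator B x / q x))"
  define g where "g x = (q x / (2 * lam)) *\<^sub>R u x" for x
  have [measurable]: "g \<in> borel_measurable borel" unfolding g_def[abs_def] by measurable
  have g0: "g x = 0" if "x \<notin> B" for x using that by (simp add: g_def u_def)
  have N: "finite_measure N" "sets N = sets borel"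
    unfolding N_def using density_divide_finite[OF B(2)] by simp_all
  note N(2)[measurable_cong]
  have NQ: "(\<integral>\<^sup>+x. ennreal ((norm (f x))\<^sup>2) \<partial>N) = (\<integral>\<^sup>+x. ennreal ((norm ((1 / q x) *\<^sub>R f x))\<^sup>2) \<partial>?Q)"
    if f[measurable]: "f \<in> borel_measurable borel" and f0: "\<And>x. x \<notin> B \<Longrightarrow> f x = 0" for f :: "real^'m \<Rightarrow> real^'m"
  proof -
    have "(\<integral>\<^sup>+x. ennreal ((norm (f x))\<^sup>2) \<partial>N)
        = (\<integral>\<^sup>+x. ennreal (indicator B x / q x) * ennreal ((norm (f x))\<^sup>2) \<partial>lborel)"
      unfolding N_def by (rule nn_integral_density) measurable
    also have "\<dots> = (\<integral>\<^sup>+x. ennreal (q x) * ennreal ((norm ((1 / q x) *\<^sub>R f x))\<^sup>2) \<partial>lborel)"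
    proof (rule nn_integral_cong)
      fix x
      have "indicator B x / q x * (norm (f x))\<^sup>2 = q x * (norm ((1 / q x) *\<^sub>R f x))\<^sup>2"
        using f0[of x] pos[of x] by (cases "x \<in> B") (auto simp: power2_eq_square)
      then show "ennreal (indicator B x / q x) * ennreal ((norm (f x))\<^sup>2) = ennreal (q x) * ennreal ((norm ((1 / q x) *\<^sub>R f x))\<^sup>2)"
        using pos[of x] by (simp flip: ennreal_mult)
    qed
    also have "\<dots> = (\<integral>\<^sup>+x. ennreal ((norm ((1 / q x) *\<^sub>R f x))\<^sup>2) \<partial>?Q)"
      by (rule nn_integral_distr_of[OF q, symmetric]) measurable
    finally show ?thesis .
  qed
  have "integrable ?Q (\<lambda>x. (norm (u x))\<^sup>2)"
    by (rule integrableI_bounded) (use fin in \<open>simp_all add: u_def\<close>)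
  note u_int = this
  have u_val: "(LINT x|?Q. (norm (u x))\<^sup>2) = r"
    using nn_integral_eq_integral[OF u_int] fin r by (simp add: u_def)
  have gu: "(1 / q x) *\<^sub>R g x = (1 / (2 * lam)) *\<^sub>R u x" for x
    using pos[of x] by (simp add: g_def)
  have "(\<integral>\<^sup>+x. ennreal ((norm (g x))\<^sup>2) \<partial>N) = (\<integral>\<^sup>+x. ennreal ((norm ((1 / (2 * lam)) *\<^sub>R u x))\<^sup>2) \<partial>?Q)"
    by (subst NQ) (simp_all add: g0 gu)
  also have "\<dots> = (LINT x|?Q. (norm ((1 / (2 * lam)) *\<^sub>R u x))\<^sup>2)"
    by (rule nn_integral_eq_integral) (use u_int in \<open>simp_all add: power_divide\<close>)
  finally have "(\<integral>\<^sup>+x. ennreal ((norm (g x))\<^sup>2) \<partial>N) < \<infinity>" by simp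
  then have "L2_approximable N B g"
    by (intro L2_approximable_square_integrable N B g0) measurable
  then obtain F where F: "F \<in> test_maps B" "(\<integral>\<^sup>+x. ennreal ((norm (F x - g x))\<^sup>2) \<partial>N) < ennreal e"
    using e unfolding L2_approximable_def by blast
  have [measurable]: "F \<in> borel_measurable borel" using F(1) by (rule test_maps_borel_measurable) simp
  have F0: "F x = 0" if "x \<notin> B" for x using F(1) that by (simp add: test_maps_def)
  define \<phi> where "\<phi> x = (1 / q x) *\<^sub>R F x" for x
  have [measurable]: "\<phi> \<in> borel_measurable borel" unfolding \<phi>_def[abs_def] by measurable
  define d where "d x = \<phi> x - (1 / (2 * lam)) *\<^sub>R u x" for x
  have [measurable]: "d \<in> borel_measurable borel" unfolding d_def[abs_def] by measurable
  have "(\<integral>\<^sup>+x. ennreal ((norm (F x - g x))\<^sup>2) \<partial>N) = (\<integral>\<^sup>+x. ennreal ((norm (d x))\<^sup>2) \<partial>?Q)"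
    by (subst NQ) (simp_all add: g0 F0 d_def \<phi>_def gu scaleR_diff_right)
  then have d_lt: "(\<integral>\<^sup>+x. ennreal ((norm (d x))\<^sup>2) \<partial>?Q) < ennreal e" using F(2) by simp
  have d_int: "integrable ?Q (\<lambda>x. (norm (d x))\<^sup>2)"
    by (rule integrableI_bounded) (use less_trans[OF d_lt ennreal_less_top] in simp_all)
  have d_val: "(LINT x|?Q. (norm (d x))\<^sup>2) \<le> e"
    using nn_integral_eq_integral[OF d_int] d_lt e by (simp add: ennreal_less_iff)
  have \<phi>_int: "integrable ?Q (\<lambda>x. (norm (\<phi> x))\<^sup>2)"
  proof (rule Bochner_Integration.integrable_bound)
    show "integrable ?Q (\<lambda>x. 2 * (norm (d x))\<^sup>2 + 2 * ((norm (u x))\<^sup>2 / (2 * lam)\<^sup>2))"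
      using d_int u_int by simp
    show "AE x in ?Q. norm ((norm (\<phi> x))\<^sup>2) \<le> norm (2 * (norm (d x))\<^sup>2 + 2 * ((norm (u x))\<^sup>2 / (2 * lam)\<^sup>2))"
    proof (rule AE_I2)
      fix x
      have "(norm (d x + (1 / (2 * lam)) *\<^sub>R u x))\<^sup>2 \<le> 2 * (norm (d x))\<^sup>2 + 2 * (norm ((1 / (2 * lam)) *\<^sub>R u x))\<^sup>2"
        by (rule norm_add_squared_le)
      then show "norm ((norm (\<phi> x))\<^sup>2) \<le> norm (2 * (norm (d x))\<^sup>2 + 2 * ((norm (u x))\<^sup>2 / (2 * lam)\<^sup>2))"
        by (simp add: d_def power_divide)
    qed
  qed measurable
  \<comment> \<open>The field vanishes off \<open>B\<close>, so truncating the score difference does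
    not affect the inner product.\<close>
  have u\<phi>: "u x \<bullet> \<phi> x = score_diff x \<bullet> \<phi> x" for x
    using F0[of x] by (cases "x \<in> B") (simp_all add: u_def \<phi>_def)
  have square: "score_diff x \<bullet> \<phi> x = (norm (u x))\<^sup>2 / (4 * lam) - lam * (norm (d x))\<^sup>2 + lam * (norm (\<phi> x))\<^sup>2" for x
    using complete_square[of "u x" "\<phi> x"] by (simp add: u\<phi> d_def)
  \<comment> \<open>The mixed term is a combination of three integrable squares by the
    completed-square identity, so no Cauchy-Schwarz estimate is used.\<close>
  have c_int: "integrable ?Q (\<lambda>x. score_diff x \<bullet> \<phi> x)"
    unfolding square using u_int d_int \<phi>_int by simp
  have stein: "has_bochner_integral ?Q (stein_op q \<phi>) 0"
    using stein_identity_divide_density[OF q F(1) B(2)] by (simp add: \<phi>_def[abs_def])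
  have "stein_op p \<phi> = (\<lambda>x. stein_op q \<phi> x + score_diff x \<bullet> \<phi> x)"
    by (simp add: stein_op_def inner_diff_left fun_eq_iff)
  then have "integrable ?Q (stein_op p \<phi>)"
    using c_int stein by (simp add: has_bochner_integral_iff)
  moreover have "\<phi> differentiable (at x)" for x
    unfolding \<phi>_def[abs_def] using F(1) smooth_density_differentiable[OF q] pos[of x]
    by (intro differentiable_scaleR differentiable_divide) (auto simp: test_maps_def)
  ultimately have adm: "\<phi> \<in> admissible q p"
    using stein \<phi>_int by (simp add: admissible_def differentiable_on_def)
  have "RSD lam q p \<phi> = (LINT x|?Q. (norm (u x))\<^sup>2 / (4 * lam) - lam * (norm (d x))\<^sup>2)"
    unfolding RSD_eq(2)[OF adm] square by simp
  also have "\<dots> = r / (4 * lam) - lam * (LINT x|?Q. (norm (d x))\<^sup>2)"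
    using u_int d_int by (simp add: u_val)
  finally have "RSD lam q p \<phi> \<ge> r / (4 * lam) - lam * e"
    using mult_left_mono[OF d_val, of lam] lam by simp
  with adm show ?thesis by blast
qed

theorem optimal_loss_eq:
  "optimal_loss lam q p = ereal (1 / (4 * lam)) * enn2ereal (fisher_div q p)"
proof (rule antisym)
  let ?Q = "distr_of q" and ?c = "1 / (4 * lam)"
  let ?N = "density ?Q (\<lambda>x. ennreal ((norm (score_diff x))\<^sup>2))"
  show "optimal_loss lam q p \<le> ereal ?c * enn2ereal (fisher_div q p)"
    unfolding optimal_loss_def by (rule SUP_least) (rule RSD_le_fisher_div)
  obtain Dp :: "nat \<Rightarrow> real^'m \<Rightarrow> real^'m" where Dp: "\<And>n. continuous_on UNIV (Dp n)" "\<And>x. (\<lambda>n. Dp n x) \<longlonglongrightarrow> score p x"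
    using score_limit_continuous[OF p] by blast
  obtain Dq :: "nat \<Rightarrow> real^'m \<Rightarrow> real^'m" where Dq: "\<And>n. continuous_on UNIV (Dq n)" "\<And>x. (\<lambda>n. Dq n x) \<longlonglongrightarrow> score q x"
    using score_limit_continuous[OF q] by blast
  obtain B :: "nat \<Rightarrow> (real^'m) set" where B: "\<And>n. open (B n)" "\<And>n. bounded (B n)"
    "\<And>n. emeasure ?N (B n) < \<infinity>" "(SUP n. emeasure ?N (B n)) = emeasure ?N UNIV"
    by (rule square_integral_exhaustion[OF distr_of_finite[OF q] sets_distr_of[OF q]
        continuous_on_diff[OF Dp(1) Dq(1)] tendsto_diff[OF Dp(2) Dq(2)]]) (rule that)
  note [measurable] = measurable_distr_of[OF score_diff_measurable]
  have emN: "emeasure ?N S = (\<integral>\<^sup>+x. ennreal ((norm (indicator S x *\<^sub>R score_diff x))\<^sup>2) \<partial>?Q)"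
    if "S \<in> sets borel" for S
    using that
    by (subst emeasure_density)
       (auto simp: sets_distr_of[OF q] indicator_def intro!: nn_integral_cong)
  have le: "ereal ?c * enn2ereal (emeasure ?N (B n)) \<le> optimal_loss lam q p" for n
  proof -
    obtain r where r: "r \<ge> 0" "emeasure ?N (B n) = ennreal r"
      using B(3)[of n] by (cases "emeasure ?N (B n)") auto
    have "ereal (?c * r) \<le> optimal_loss lam q p"
    proof (rule ereal_le_epsilon2)
      fix e :: real assume "e > 0"
      \<comment> \<open>The loss in \<open>RSD_approximates\<close> is multiplied by
        \<open>lam\<close>; this choice makes it exactly \<open>e\<close>.\<close>
      then have "e / lam > 0" using lam by simp
      have "(\<integral>\<^sup>+x. ennreal ((norm (indicator (B n) x *\<^sub>R score_diff x))\<^sup>2) \<partial>?Q) = ennreal r"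
        using emN[of "B n"] B(1)[of n] r(2) by (simp only: borel_open)
      from RSD_approximates[OF B(1,2) this r(1) \<open>e / lam > 0\<close>]
      obtain \<phi> where \<phi>: "\<phi> \<in> admissible q p" "RSD lam q p \<phi> \<ge> r / (4 * lam) - lam * (e / lam)"
        by blast
      then have "ereal (?c * r) \<le> ereal (RSD lam q p \<phi>) + ereal e"
        using lam by simp
      also have "\<dots> \<le> optimal_loss lam q p + ereal e"
        unfolding optimal_loss_def by (intro add_right_mono SUP_upper \<phi>)
      finally show "ereal (?c * r) \<le> optimal_loss lam q p + ereal e" .
    qed
    then show ?thesis using r by (simp add: enn2ereal_ennreal)
  qed
  \<comment> \<open>Nonnegativity allows the loss to be read as an \<open>ennreal\<close>, where
    multiplication by a constant commutes with suprema, also when the divergence is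
    infinite.\<close>
  have "0 \<le> ereal ?c * enn2ereal (emeasure ?N (B 0))" using lam by simp
  then have "0 \<le> optimal_loss lam q p" using le[of 0] by (rule order_trans)
  then obtain l where l: "optimal_loss lam q p = enn2ereal l"
    by (metis enn2ereal_e2ennreal)
  have scale: "ereal ?c * enn2ereal a = enn2ereal (ennreal ?c * a)" for a
    using lam by (simp add: times_ennreal.rep_eq enn2ereal_ennreal)
  have "ennreal ?c * emeasure ?N (B n) \<le> l" for n
    using le[of n] unfolding scale l by (simp add: less_eq_ennreal.rep_eq)
  then have "(SUP n. ennreal ?c * emeasure ?N (B n)) \<le> l" by (rule SUP_least)
  then have "ennreal ?c * emeasure ?N UNIV \<le> l"
    by (simp add: B(4) flip: SUP_mult_left_ennreal)
  moreover have "emeasure ?N UNIV = fisher_div q p"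
    by (subst emN) (simp_all add: fisher_div_eq)
  ultimately show "ereal ?c * enn2ereal (fisher_div q p) \<le> optimal_loss lam q p"
    unfolding scale l by (simp add: less_eq_ennreal.rep_eq)
qed

end

theorem theorem2:
  fixes q :: "'theta \<Rightarrow> real^'m \<Rightarrow> real"
    and p :: "'data \<Rightarrow> 'nu \<Rightarrow> real^'m \<Rightarrow> real"
    and \<Theta> :: "'theta set" and \<D> :: 'data and \<nu> :: 'nu and lam :: real
  assumes "\<And>\<theta>. \<theta> \<in> \<Theta> \<Longrightarrow> smooth_density (q \<theta>)"
    and "smooth_density (p \<D> \<nu>)"
    and "lam > 0"
  shows "(\<forall>\<theta>\<in>\<Theta>. optimal_loss lam (q \<theta>) (p \<D> \<nu>) =
            ereal (1 / (4 * lam)) * enn2ereal (fisher_div (q \<theta>) (p \<D> \<nu>))) \<and>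
         (\<forall>\<theta>. is_arg_min (\<lambda>\<theta>. optimal_loss lam (q \<theta>) (p \<D> \<nu>)) (\<lambda>\<theta>. \<theta> \<in> \<Theta>) \<theta> \<longleftrightarrow>
              is_arg_min (\<lambda>\<theta>. fisher_div (q \<theta>) (p \<D> \<nu>)) (\<lambda>\<theta>. \<theta> \<in> \<Theta>) \<theta>)"
proof -
  have eq: "optimal_loss lam (q \<theta>) (p \<D> \<nu>) = ereal (1 / (4 * lam)) * enn2ereal (fisher_div (q \<theta>) (p \<D> \<nu>))"
    if "\<theta> \<in> \<Theta>" for \<theta>
    using assms that by (intro optimal_loss_eq)
  \<comment> \<open>A positive finite factor preserves and reflects the order even at infinity, so
    the two objectives have the same minimizers also when some divergences are infinite.\<close>
  have le: "ereal (1 / (4 * lam)) * enn2ereal a \<le> ereal (1 / (4 * lam)) * enn2ereal b \<longleftrightarrow> a \<le> b" for a b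
    using \<open>lam > 0\<close> by (subst ereal_mult_le_mult_iff) (simp_all add: less_eq_ennreal.rep_eq)
  have less: "optimal_loss lam (q \<theta>) (p \<D> \<nu>) < optimal_loss lam (q \<theta>') (p \<D> \<nu>) \<longleftrightarrow>
      fisher_div (q \<theta>) (p \<D> \<nu>) < fisher_div (q \<theta>') (p \<D> \<nu>)" if "\<theta> \<in> \<Theta>" "\<theta>' \<in> \<Theta>" for \<theta> \<theta>'
    unfolding eq[OF that(1)] eq[OF that(2)] by (simp only: le not_le[symmetric])
  show ?thesis
    using eq less by (auto simp: is_arg_min_def)
qed

end
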